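(* Let $\Gamma=\mathrm{PSL}(2,\mathbb{Z})$ act on $\mathbb{R}\cup\{\infty\}$ by Möbius transformations and let $\Gamma_\infty\leq\Gamma$ be the stabilizer of $\infty$. Then the action of $\Gamma$ on $B(\Gamma,\Gamma_\infty)$ is topologically free but not free. In particular, $B(\Gamma,\Gamma_\infty)$ is not extremally disconnected.
   Context: Groups are discrete. The stabilizer $\Gamma_\infty$ consists of the translations $x\mapsto x+n$, $n\in\mathbb{Z}$, and is isomorphic to $\mathbb{Z}$. For an action of a group $G$ by homeomorphisms on a compact Hausdorff space $X$: the action is minimal if $X$ contains no non-trivial (non-empty proper) closed invariant subset; it is proximal if for all $x,y\in X$ there is a net $(g_i)\subset G$ such that $(g_ix)$ and $(g_iy)$ converge and $\lim g_ix=\lim g_iy$; it is strongly proximal if the induced action of $G$ on the space $\mathrm{Prob}(X)$ of regular probability measures on $X$ (weak* topology) is proximal. $X$ is a $G$-boundary if the action is minimal and strongly proximal. The action is topologically free if for every $g\in G\setminus\{e\}$ the set $\{x\in X:gx=x\}$ has empty interior. For groups $\Lambda\leq\Gamma$, $B(\Gamma,\Lambda)$ denotes the universal $\Lambda$-strongly proximal $\Gamma$-boundary (Ursu): it is a $\Gamma$-boundary on which the restricted action of $\Lambda$ is strongly proximal, and every $\Gamma$-boundary on which $\Lambda$ acts strongly proximally is a continuous $\Gamma$-equivariant image of it. *)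

theory Defs
  imports
    "HOL-Analysis.Analysis"
    "HOL-Probability.Probability_Measure"
    "HOL-Algebra.Group_Action"
begin

section \<open>Actions on compact Hausdorff spaces\<close>

text \<open>
  An action of \<open>G\<close> on a space \<open>X\<close> is a \<open>group_action\<close> on \<open>topspace X\<close>; in particular each
  \<open>\<phi> g\<close> is extensional. The restriction of the action to a subgroup \<open>H\<close> is the same \<open>\<phi>\<close>,
  taken over the group \<open>G\<lparr>carrier := H\<rparr>\<close>. Compact spaces carrying an action are nonempty.
\<close>

definition compact_action :: "('g, 'm) monoid_scheme \<Rightarrow> 'x topology \<Rightarrow> ('g \<Rightarrow> 'x \<Rightarrow> 'x) \<Rightarrow> bool"
  where "compact_action G X \<phi> \<longleftrightarrow>
    compact_space X \<and> Hausdorff_space X \<and> topspace X \<noteq> {} \<and>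
    group_action G (topspace X) \<phi> \<and>
    (\<forall>g\<in>carrier G. homeomorphic_map X X (\<phi> g))"

definition minimal_action :: "('g, 'm) monoid_scheme \<Rightarrow> 'x topology \<Rightarrow> ('g \<Rightarrow> 'x \<Rightarrow> 'x) \<Rightarrow> bool"
  where "minimal_action G X \<phi> \<longleftrightarrow>
    (\<forall>S. closedin X S \<and> (\<forall>g\<in>carrier G. \<phi> g ` S \<subseteq> S) \<longrightarrow> S = {} \<or> S = topspace X)"

text \<open>
  A net \<open>(g\<^sub>i)\<close> in \<open>G\<close> is represented by the filter on \<open>carrier G\<close> that its tails generate;
  conversely, every proper filter on \<open>carrier G\<close> arises from a net, with the same limits.
\<close>

definition proximal_action :: "('g, 'm) monoid_scheme \<Rightarrow> 'x topology \<Rightarrow> ('g \<Rightarrow> 'x \<Rightarrow> 'x) \<Rightarrow> bool"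
  where "proximal_action G X \<phi> \<longleftrightarrow>
    (\<forall>x\<in>topspace X. \<forall>y\<in>topspace X. \<exists>F z.
      F \<noteq> bot \<and> (\<forall>\<^sub>F g in F. g \<in> carrier G) \<and>
      limitin X (\<lambda>g. \<phi> g x) z F \<and> limitin X (\<lambda>g. \<phi> g y) z F)"

definition borel_on :: "'x topology \<Rightarrow> 'x measure"
  where "borel_on X = sigma (topspace X) {U. openin X U}"

definition regular_measure :: "'x topology \<Rightarrow> 'x measure \<Rightarrow> bool"
  where "regular_measure X \<mu> \<longleftrightarrow>
    (\<forall>A\<in>sets \<mu>.
      emeasure \<mu> A = (SUP K\<in>{K. K \<in> sets \<mu> \<and> compactin X K \<and> K \<subseteq> A}. emeasure \<mu> K) \<and>
      emeasure \<mu> A = (INF U\<in>{U. openin X U \<and> A \<subseteq> U}. emeasure \<mu> U))"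

definition Prob :: "'x topology \<Rightarrow> 'x measure set"
  where "Prob X = {\<mu>. sets \<mu> = sets (borel_on X) \<and> prob_space \<mu> \<and> regular_measure X \<mu>}"

definition weak_star :: "'x topology \<Rightarrow> 'x measure topology"
  where "weak_star X = topology_generated_by
    {{\<mu> \<in> Prob X. (\<integral>x. f x \<partial>\<mu>) \<in> U} | f U.
      continuous_map X euclideanreal f \<and> open U}"

lemma topspace_weak_star [simp]: "topspace (weak_star X) = Prob X"
proof -
  have "\<exists>f U. Prob X = {\<mu> \<in> Prob X. (\<integral>x. f x \<partial>\<mu>) \<in> U} \<and>
      continuous_map X euclideanreal f \<and> open U"
    by (rule exI[of _ "\<lambda>_. 0"], rule exI[of _ UNIV]) auto
  then show ?thesis
    unfolding weak_star_def topology_generated_by_topspace by auto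
qed

definition push_action :: "'x topology \<Rightarrow> ('g \<Rightarrow> 'x \<Rightarrow> 'x) \<Rightarrow> 'g \<Rightarrow> 'x measure \<Rightarrow> 'x measure"
  where "push_action X \<phi> g = (\<lambda>\<mu>\<in>Prob X. distr \<mu> (borel_on X) (\<phi> g))"

definition strongly_proximal_action ::
    "('g, 'm) monoid_scheme \<Rightarrow> 'x topology \<Rightarrow> ('g \<Rightarrow> 'x \<Rightarrow> 'x) \<Rightarrow> bool"
  where "strongly_proximal_action G X \<phi> \<longleftrightarrow>
    proximal_action G (weak_star X) (push_action X \<phi>)"

definition boundary_action :: "('g, 'm) monoid_scheme \<Rightarrow> 'x topology \<Rightarrow> ('g \<Rightarrow> 'x \<Rightarrow> 'x) \<Rightarrow> bool"
  where "boundary_action G X \<phi> \<longleftrightarrow>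
    compact_action G X \<phi> \<and> minimal_action G X \<phi> \<and> strongly_proximal_action G X \<phi>"

definition free_action :: "('g, 'm) monoid_scheme \<Rightarrow> 'x topology \<Rightarrow> ('g \<Rightarrow> 'x \<Rightarrow> 'x) \<Rightarrow> bool"
  where "free_action G X \<phi> \<longleftrightarrow>
    (\<forall>g\<in>carrier G - {\<one>\<^bsub>G\<^esub>}. {x \<in> topspace X. \<phi> g x = x} = {})"

definition topologically_free_action ::
    "('g, 'm) monoid_scheme \<Rightarrow> 'x topology \<Rightarrow> ('g \<Rightarrow> 'x \<Rightarrow> 'x) \<Rightarrow> bool"
  where "topologically_free_action G X \<phi> \<longleftrightarrow>
    (\<forall>g\<in>carrier G - {\<one>\<^bsub>G\<^esub>}. X interior_of {x \<in> topspace X. \<phi> g x = x} = {})"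

definition extremally_disconnected :: "'x topology \<Rightarrow> bool"
  where "extremally_disconnected X \<longleftrightarrow> (\<forall>U. openin X U \<longrightarrow> openin X (X closure_of U))"


section \<open>The universal \<open>L\<close>-strongly proximal \<open>G\<close>-boundary\<close>

text \<open>
  A definition cannot quantify over all types. The universal property is therefore tested on
  the spaces \<open>Y\<close> whose points are elements of the type \<open>'g set set\<close>. This is no restriction:
  by \<open>minimal_space_embeds\<close> below, every minimal compact Hausdorff \<open>G\<close>-space, on whatever type,
  is in bijection with a subset of that type, and hence is isomorphic to such a \<open>Y\<close>.
  The space \<open>X\<close> itself may live on any type; the universal property determines it up to
  isomorphism.
\<close>

definition universal_boundary ::
    "('g, 'm) monoid_scheme \<Rightarrow> 'g set \<Rightarrow> 'x topology \<Rightarrow> ('g \<Rightarrow> 'x \<Rightarrow> 'x) \<Rightarrow> bool"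
  where "universal_boundary G L X \<phi> \<longleftrightarrow>
    boundary_action G X \<phi> \<and> strongly_proximal_action (G\<lparr>carrier := L\<rparr>) X \<phi> \<and>
    (\<forall>(Y :: 'g set set topology) \<psi>.
      boundary_action G Y \<psi> \<and> strongly_proximal_action (G\<lparr>carrier := L\<rparr>) Y \<psi> \<longrightarrow>
      (\<exists>f. continuous_map X Y f \<and> f ` topspace X = topspace Y \<and>
        (\<forall>g\<in>carrier G. \<forall>x\<in>topspace X. f (\<phi> g x) = \<psi> g (f x))))"

lemma minimal_space_embeds:
  fixes G :: "('g, 'm) monoid_scheme" and X :: "'x topology"
  assumes "compact_action G X \<phi>" "minimal_action G X \<phi>"
  shows "\<exists>h :: 'x \<Rightarrow> 'g set set. inj_on h (topspace X)"
proof -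
  interpret group_action G "topspace X" \<phi>
    using assms(1) by (simp add: compact_action_def)
  interpret gh: group_hom G "BijGroup (topspace X)" \<phi> by (rule group_hom)
  have haus: "Hausdorff_space X" and homeo: "\<And>g. g \<in> carrier G \<Longrightarrow> homeomorphic_map X X (\<phi> g)"
    using assms(1) by (auto simp: compact_action_def)
  obtain x0 where x0: "x0 \<in> topspace X"
    using assms(1) unfolding compact_action_def by blast
  define orb where "orb = (\<lambda>g. \<phi> g x0) ` carrier G"
  have orb_sub: "orb \<subseteq> topspace X"
    unfolding orb_def using element_image x0 by blast
  have "\<phi> g ` (X closure_of orb) \<subseteq> X closure_of orb" if g: "g \<in> carrier G" for g
  proof -
    have "\<phi> g ` orb \<subseteq> orb"
    proof -
      have "\<phi> g (\<phi> k x0) = \<phi> (g \<otimes>\<^bsub>G\<^esub> k) x0" if "k \<in> carrier G" for k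
        using composition_rule[OF x0 g that] by simp
      then show ?thesis unfolding orb_def using gh.G.m_closed[OF g] by blast
    qed
    then have "X closure_of (\<phi> g ` orb) \<subseteq> X closure_of orb"
      by (rule closure_of_mono)
    then show ?thesis
      using continuous_map_image_closure_subset[OF homeomorphic_imp_continuous_map[OF homeo[OF g]]]
      by blast
  qed
  moreover have "X closure_of orb \<noteq> {}"
  proof -
    have "orb \<noteq> {}" unfolding orb_def using gh.G.one_closed by blast
    then show ?thesis using closure_of_subset[OF orb_sub] by blast
  qed
  ultimately have dense: "X closure_of orb = topspace X"
    using assms(2) unfolding minimal_action_def by (metis closedin_closure_of)
  define h where "h x = {A. A \<subseteq> carrier G \<and> x \<in> X closure_of ((\<lambda>g. \<phi> g x0) ` A)}" for x
  have "h x \<noteq> h y" if xy: "x \<in> topspace X" "y \<in> topspace X" "x \<noteq> y" for x y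
  proof -
    obtain U V where UV: "openin X U" "openin X V" "x \<in> U" "y \<in> V" "disjnt U V"
      using haus xy unfolding Hausdorff_space_def by metis
    define A where "A = {g \<in> carrier G. \<phi> g x0 \<in> U}"
    have im: "(\<lambda>g. \<phi> g x0) ` A = U \<inter> orb"
      unfolding A_def orb_def by auto
    have "x \<in> X closure_of (U \<inter> orb)"
      using openin_Int_closure_of_subset[OF UV(1)] dense UV(3) xy(1) by blast
    then have "A \<in> h x" unfolding h_def mem_Collect_eq im by (auto simp: A_def)
    moreover have "y \<notin> X closure_of (U \<inter> orb)"
      using UV unfolding in_closure_of disjnt_def by blast
    then have "A \<notin> h y" unfolding h_def mem_Collect_eq im by blast
    ultimately show ?thesis by blast
  qed
  then have "inj_on h (topspace X)" by (auto simp: inj_on_def)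
  then show ?thesis by blast
qed


section \<open>The modular group\<close>

definition SL2Z :: "(int^2^2) monoid"
  where "SL2Z = \<lparr>carrier = {A. det A = 1}, mult = (**), one = mat 1\<rparr>"

definition PSL2Z :: "(int^2^2) set monoid"
  where "PSL2Z = SL2Z Mod {mat 1, - mat 1}"

lemma group_SL2Z: "group SL2Z"
proof (rule groupI)
  fix A assume A: "A \<in> carrier SL2Z"
  define B :: "int^2^2" where
    "B = (\<chi> i j. if i = j then (if i = 1 then A$2$2 else A$1$1) else - A$i$j)"
  have "A$1$1 * A$2$2 - A$1$2 * A$2$1 = 1"
    using A by (simp add: SL2Z_def det_2)
  then have "det B = 1" "B ** A = mat 1"
    by (simp_all add: B_def det_2 vec_eq_iff forall_2 matrix_matrix_mult_def sum_2 mat_def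
        algebra_simps)
  then show "\<exists>B\<in>carrier SL2Z. B \<otimes>\<^bsub>SL2Z\<^esub> A = \<one>\<^bsub>SL2Z\<^esub>"
    by (auto simp: SL2Z_def)
qed (auto simp: SL2Z_def det_mul matrix_mul_assoc)

lemma minus_matrix_mult:
  fixes A B :: "int^2^2"
  shows "(- A) ** B = - (A ** B)" "A ** (- B) = - (A ** B)"
  by (simp_all add: vec_eq_iff forall_2 matrix_matrix_mult_def sum_2)

lemma det_minus_2 [simp]: "det (- A) = det (A :: int^2^2)"
  by (simp add: det_2)

lemma normal_center_SL2Z: "{mat 1, - mat 1} \<lhd> SL2Z"
proof -
  interpret group SL2Z by (rule group_SL2Z)
  have one: "\<one>\<^bsub>SL2Z\<^esub> = mat 1" by (simp add: SL2Z_def)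
  have neg: "- mat 1 \<in> carrier SL2Z" by (simp add: SL2Z_def)
  have sq: "(- mat 1) \<otimes>\<^bsub>SL2Z\<^esub> (- mat 1) = mat 1"
    by (simp add: SL2Z_def minus_matrix_mult)
  have invneg: "inv\<^bsub>SL2Z\<^esub> (- mat 1) = - mat 1"
    by (rule inv_equality) (use neg sq one in auto)
  have "subgroup {mat 1, - mat 1} SL2Z"
  proof (rule subgroupI)
    fix a b :: "int^2^2" assume "a \<in> {mat 1, - mat 1}" "b \<in> {mat 1, - mat 1}"
    then show "a \<otimes>\<^bsub>SL2Z\<^esub> b \<in> {mat 1, - mat 1}"
      by (auto simp: SL2Z_def minus_matrix_mult)
  next
    fix a :: "int^2^2" assume "a \<in> {mat 1, - mat 1}"
    then show "inv\<^bsub>SL2Z\<^esub> a \<in> {mat 1, - mat 1}"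
      using invneg inv_one one by auto
  qed (auto simp: SL2Z_def)
  then show ?thesis
  proof (rule normalI)
    show "\<forall>x\<in>carrier SL2Z. {mat 1, - mat 1} #>\<^bsub>SL2Z\<^esub> x = x <#\<^bsub>SL2Z\<^esub> {mat 1, - mat 1}"
      by (auto simp: r_coset_def l_coset_def SL2Z_def minus_matrix_mult)
  qed
qed

lemma carrier_PSL2Z: "carrier PSL2Z = {{A, - A} | A. det A = 1}"
  by (auto simp: PSL2Z_def carrier_FactGroup r_coset_def SL2Z_def minus_matrix_mult)

lemma group_PSL2Z: "group PSL2Z"
  unfolding PSL2Z_def by (rule normal.factorgroup_is_group[OF normal_center_SL2Z])

text \<open>\<open>None\<close> is the point at infinity.\<close>

definition moebius :: "int^2^2 \<Rightarrow> real option \<Rightarrow> real option"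
  where "moebius A p =
    (let a = real_of_int (A$1$1); b = real_of_int (A$1$2);
         c = real_of_int (A$2$1); d = real_of_int (A$2$2)
     in case p of
          None \<Rightarrow> if c = 0 then None else Some (a / c)
        | Some x \<Rightarrow> if c * x + d = 0 then None else Some ((a * x + b) / (c * x + d)))"

definition psl_moebius :: "(int^2^2) set \<Rightarrow> real option \<Rightarrow> real option"
  where "psl_moebius C p = the_elem ((\<lambda>A. moebius A p) ` C)"

lemma moebius_minus [simp]: "moebius (- A) p = moebius A p"
proof -
  have "- (c * x) - d = 0 \<longleftrightarrow> c * x + d = 0"
    "(- (a * x) - b) / (- (c * x) - d) = (a * x + b) / (c * x + d)" for a b c d x :: real
    using minus_divide_divide[of "a * x + b" "c * x + d"] by auto
  then show ?thesis
    by (cases p) (simp_all add: moebius_def Let_def)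
qed

lemma psl_moebius_eq [simp]: "psl_moebius {A, - A} p = moebius A p"
  by (simp add: psl_moebius_def)

definition Gamma_inf :: "(int^2^2) set set"
  where "Gamma_inf = stabilizer PSL2Z psl_moebius None"

lemma Gamma_inf_eq: "Gamma_inf = {{A, - A} | A. \<exists>n. A = vector [vector [1, n], vector [0, 1]]}"
proof (intro equalityI subsetI)
  fix C assume "C \<in> Gamma_inf"
  then obtain A :: "int^2^2" where A: "C = {A, - A}" "det A = 1" "moebius A None = None"
    by (auto simp: Gamma_inf_def stabilizer_def carrier_PSL2Z)
  then have c: "A$2$1 = 0"
    by (auto simp: moebius_def Let_def split: if_splits)
  with A(2) have "A$1$1 * A$2$2 = 1" by (simp add: det_2)
  then have "A$1$1 = 1 \<and> A$2$2 = 1 \<or> A$1$1 = -1 \<and> A$2$2 = -1"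
    using zmult_eq_1_iff by blast
  then have "A = vector [vector [1, A$1$2], vector [0, 1]] \<or>
      - A = vector [vector [1, - A$1$2], vector [0, 1]]"
    using c by (auto simp: vec_eq_iff forall_2)
  then show "C \<in> {{A, - A} | A. \<exists>n. A = vector [vector [1, n], vector [0, 1]]}"
  proof
    assume "- A = vector [vector [1, - A$1$2], vector [0, 1]]"
    moreover have "C = {- A, - (- A)}" using A(1) by auto
    ultimately show ?thesis by blast
  qed (use A(1) in blast)
next
  fix C :: "(int^2^2) set"
  assume "C \<in> {{A, - A} | A. \<exists>n. A = vector [vector [1, n], vector [0, 1]]}"
  then obtain A :: "int^2^2" and n where "C = {A, - A}" "A = vector [vector [1, n], vector [0, 1]]"
    by auto
  moreover from this have "det A = 1" "moebius A None = None"
    by (simp_all add: det_2 moebius_def)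
  ultimately show "C \<in> Gamma_inf"
    by (auto simp: Gamma_inf_def stabilizer_def carrier_PSL2Z)
qed

end

theory Submission
  imports Defs "HOL-Probability.Giry_Monad"
begin

text \<open>
  The translations push every point of the projective line to infinity, so by dominated
  convergence they push every probability measure to a Dirac measure, and the line is a quotient of
  \<open>B\<close>. A non-identity element fixes at most two points of the line, while a nonempty open subset of
  \<open>B\<close> has infinite image there by minimality; hence the action on \<open>B\<close> is topologically free.
  On the other hand \<open>\<Gamma>\<^sub>\<infinity>\<close> is abelian and proximal on \<open>B\<close>: if \<open>x\<close> and \<open>t x\<close> are
  moved to a common limit by elements commuting with \<open>t\<close>, this limit is fixed by \<open>t\<close>. In an
  extremally disconnected space the fixed point set of a homeomorphism is open (Frolik), which
  would contradict topological freeness.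
\<close>

section \<open>Probability measures and the weak-star topology\<close>

lemma space_borel_on [simp]: "space (borel_on X) = topspace X"
  unfolding borel_on_def by (rule space_measure_of) (use openin_subset in blast)

lemma sets_borel_on: "sets (borel_on X) = sigma_sets (topspace X) {U. openin X U}"
  unfolding borel_on_def by (rule sets_measure_of) (use openin_subset in blast)

lemma openin_in_borel_on: "openin X U \<Longrightarrow> U \<in> sets (borel_on X)"
  unfolding sets_borel_on by auto

lemma closedin_in_borel_on:
  assumes "closedin X C" shows "C \<in> sets (borel_on X)"
proof -
  have "topspace X - C \<in> sets (borel_on X)"
    using assms by (intro openin_in_borel_on) (simp add: closedin_def)
  from sets.compl_sets[OF this] show ?thesis
    using closedin_subset[OF assms] by (simp add: double_diff)
qed

lemma continuous_map_measurable_borel_on: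
  assumes "continuous_map X Y f" shows "f \<in> borel_on X \<rightarrow>\<^sub>M borel_on Y"
  unfolding borel_on_def[of Y]
proof (rule measurable_measure_of)
  show "f \<in> space (borel_on X) \<rightarrow> topspace Y"
    using assms by (auto simp: continuous_map_def)
  fix U assume "U \<in> {U. openin Y U}"
  then have "openin X {x \<in> topspace X. f x \<in> U}"
    using assms openin_continuous_map_preimage by blast
  moreover have "{x \<in> topspace X. f x \<in> U} = f -` U \<inter> space (borel_on X)" by auto
  ultimately show "f -` U \<inter> space (borel_on X) \<in> sets (borel_on X)"
    using openin_in_borel_on by metis
qed (use openin_subset in blast)

lemma continuous_map_borel_measurable:
  assumes "continuous_map X euclideanreal f" shows "f \<in> borel_measurable (borel_on X)"
proof (rule borel_measurableI)
  fix U :: "real set" assume "open U"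
  then have "openin X {x \<in> topspace X. f x \<in> U}"
    using assms openin_continuous_map_preimage by (metis open_openin)
  moreover have "{x \<in> topspace X. f x \<in> U} = f -` U \<inter> space (borel_on X)" by auto
  ultimately show "f -` U \<inter> space (borel_on X) \<in> sets (borel_on X)"
    using openin_in_borel_on by metis
qed

text \<open>The sets \<open>W\<close> for which \<open>\<nu> \<in> W\<close> forces
  \<open>m i \<in> W\<close> eventually are closed under finite intersections and arbitrary unions.
  Hence testing the subbasic sets suffices, and on these the condition is convergence of
  integrals.\<close>

lemma limitin_weak_star:
  "limitin (weak_star X) m \<nu> F \<longleftrightarrow> \<nu> \<in> Prob X \<and> (\<forall>\<^sub>F i in F. m i \<in> Prob X) \<and>
    (\<forall>f. continuous_map X euclideanreal f \<longrightarrow>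
      ((\<lambda>i. \<integral>x. f x \<partial>m i) \<longlongrightarrow> (\<integral>x. f x \<partial>\<nu>)) F)" (is "_ \<longleftrightarrow> ?R")
proof
  assume lim: "limitin (weak_star X) m \<nu> F"
  then have \<nu>: "\<nu> \<in> Prob X" by (simp add: limitin_def)
  moreover have "\<forall>\<^sub>F i in F. m i \<in> Prob X"
    using lim \<nu> unfolding limitin_def by (metis openin_topspace topspace_weak_star)
  moreover have "((\<lambda>i. \<integral>x. f x \<partial>m i) \<longlongrightarrow> (\<integral>x. f x \<partial>\<nu>)) F"
    if f: "continuous_map X euclideanreal f" for f
  proof (rule topological_tendstoI)
    fix U :: "real set" assume U: "open U" "(\<integral>x. f x \<partial>\<nu>) \<in> U"
    have "openin (weak_star X) {\<mu> \<in> Prob X. (\<integral>x. f x \<partial>\<mu>) \<in> U}"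
      unfolding weak_star_def by (rule topology_generated_by_Basis) (use f U in blast)
    then have "\<forall>\<^sub>F i in F. m i \<in> {\<mu> \<in> Prob X. (\<integral>x. f x \<partial>\<mu>) \<in> U}"
      using lim \<nu> U unfolding limitin_def by blast
    then show "\<forall>\<^sub>F i in F. (\<integral>x. f x \<partial>m i) \<in> U" by (rule eventually_mono) auto
  qed
  ultimately show ?R by blast
next
  assume R: ?R
  have "\<nu> \<in> W \<longrightarrow> (\<forall>\<^sub>F i in F. m i \<in> W)"
    if "generate_topology_on {{\<mu> \<in> Prob X. (\<integral>x. f x \<partial>\<mu>) \<in> U} | f U.
      continuous_map X euclideanreal f \<and> open U} W" for W
    using that
  proof induction
    case (UN K)
    show ?case
    proof
      assume "\<nu> \<in> \<Union>K"
      then obtain k where k: "k \<in> K" "\<nu> \<in> k" by blast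
      then have "\<forall>\<^sub>F i in F. m i \<in> k" using UN.IH by blast
      then show "\<forall>\<^sub>F i in F. m i \<in> \<Union>K" by (rule eventually_mono) (use k in blast)
    qed
  next
    case (Basis s)
    then obtain f U where s: "s = {\<mu> \<in> Prob X. (\<integral>x. f x \<partial>\<mu>) \<in> U}"
      "continuous_map X euclideanreal f" "open U" by blast
    show ?case
    proof
      assume "\<nu> \<in> s"
      then have "\<forall>\<^sub>F i in F. (\<integral>x. f x \<partial>m i) \<in> U"
        using R s by (auto dest: topological_tendstoD)
      with R show "\<forall>\<^sub>F i in F. m i \<in> s"
        unfolding s by (auto elim: eventually_elim2)
    qed
  qed (auto simp: eventually_conj_iff)
  then show "limitin (weak_star X) m \<nu> F"
    using R unfolding limitin_def weak_star_def openin_topology_generated_by_iff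
    by (simp add: weak_star_def[symmetric])
qed

text \<open>Both bounds are attained by explicit sets: \<open>{p}\<close> is compact and carries all
  the mass, which gives inner regularity when \<open>p \<in> A\<close>, and its complement is an
  open null set, which gives outer regularity when \<open>p \<notin> A\<close>. The Hausdorff
  property makes \<open>{p}\<close> closed, hence Borel.\<close>

lemma return_in_Prob:
  assumes X: "Hausdorff_space X" and p: "p \<in> topspace X"
  shows "return (borel_on X) p \<in> Prob X"
proof -
  let ?\<delta> = "return (borel_on X) p"
  have cl: "closedin X {p}" using X p closedin_Hausdorff_singleton by metis
  have inner: "emeasure ?\<delta> A = (SUP K\<in>{K. K \<in> sets ?\<delta> \<and> compactin X K \<and> K \<subseteq> A}. emeasure ?\<delta> K)"
    if A: "A \<in> sets (borel_on X)" for A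
  proof (rule antisym)
    show "emeasure ?\<delta> A \<le> (SUP K\<in>{K. K \<in> sets ?\<delta> \<and> compactin X K \<and> K \<subseteq> A}. emeasure ?\<delta> K)"
    proof (cases "p \<in> A")
      case True
      have K: "{p} \<in> {K. K \<in> sets ?\<delta> \<and> compactin X K \<and> K \<subseteq> A}"
        using True p closedin_in_borel_on[OF cl] by simp
      have "emeasure ?\<delta> A = emeasure ?\<delta> {p}"
        using A True closedin_in_borel_on[OF cl] by (simp add: emeasure_return)
      also have "\<dots> \<le> (SUP K\<in>{K. K \<in> sets ?\<delta> \<and> compactin X K \<and> K \<subseteq> A}. emeasure ?\<delta> K)"
        by (rule SUP_upper[OF K])
      finally show ?thesis .
    qed (simp add: emeasure_return A)
  qed (use A in \<open>auto intro!: SUP_least emeasure_mono\<close>)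
  have outer: "emeasure ?\<delta> A = (INF U\<in>{U. openin X U \<and> A \<subseteq> U}. emeasure ?\<delta> U)"
    if A: "A \<in> sets (borel_on X)" for A
  proof (rule antisym)
    show "(INF U\<in>{U. openin X U \<and> A \<subseteq> U}. emeasure ?\<delta> U) \<le> emeasure ?\<delta> A"
    proof (cases "p \<in> A")
      case True
      have U: "topspace X \<in> {U. openin X U \<and> A \<subseteq> U}" using sets.sets_into_space[OF A] by simp
      have "emeasure ?\<delta> (topspace X) \<le> emeasure ?\<delta> A"
        using True A by (simp add: emeasure_return openin_in_borel_on split: split_indicator)
      then show ?thesis using INF_lower[OF U] order_trans by blast
    next
      case False
      have U: "topspace X - {p} \<in> {U. openin X U \<and> A \<subseteq> U}"
        using False sets.sets_into_space[OF A] cl by auto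
      then have "emeasure ?\<delta> (topspace X - {p}) \<le> emeasure ?\<delta> A"
        by (simp add: emeasure_return openin_in_borel_on)
      then show ?thesis using INF_lower[OF U] order_trans by blast
    qed
  qed (auto intro!: INF_greatest emeasure_mono openin_in_borel_on)
  have "regular_measure X ?\<delta>"
    unfolding regular_measure_def sets_return
    by (intro ballI conjI inner[unfolded sets_return] outer)
  then show ?thesis
    using p by (simp add: Prob_def prob_space_return)
qed

text \<open>A homeomorphism maps the compact subsets of the preimage of \<open>A\<close> to compact
  subsets of \<open>A\<close>, and open supersets to open supersets, without changing the measure.
  So regularity of \<open>\<mu>\<close> at the preimage gives regularity of the image measure at
  \<open>A\<close>.\<close>

lemma distr_in_Prob:
  assumes h: "homeomorphic_map X X h" and \<mu>: "\<mu> \<in> Prob X"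
  shows "distr \<mu> (borel_on X) h \<in> Prob X"
proof -
  let ?\<nu> = "distr \<mu> (borel_on X) h"
  obtain k where hk: "homeomorphic_maps X X h k" using h homeomorphic_map_maps by metis
  then have ch: "continuous_map X X h" and ck: "continuous_map X X k"
    and kh: "\<And>x. x \<in> topspace X \<Longrightarrow> k (h x) = x" and hk': "\<And>x. x \<in> topspace X \<Longrightarrow> h (k x) = x"
    by (auto simp: homeomorphic_maps_def)
  have hX: "\<And>x. x \<in> topspace X \<Longrightarrow> h x \<in> topspace X"
    and kX: "\<And>x. x \<in> topspace X \<Longrightarrow> k x \<in> topspace X"
    using ch ck by (auto simp: continuous_map_def)
  have sets\<mu>: "sets \<mu> = sets (borel_on X)" and "prob_space \<mu>" and reg: "regular_measure X \<mu>"
    using \<mu> by (auto simp: Prob_def)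
  have space\<mu>: "space \<mu> = topspace X" using sets_eq_imp_space_eq[OF sets\<mu>] by simp
  have mh: "h \<in> \<mu> \<rightarrow>\<^sub>M borel_on X"
    using continuous_map_measurable_borel_on[OF ch] measurable_cong_sets[OF sets\<mu> refl] by blast
  have mk: "k \<in> borel_on X \<rightarrow>\<^sub>M borel_on X"
    using continuous_map_measurable_borel_on[OF ck] .
  have pre: "k -` A \<inter> topspace X \<in> sets (borel_on X)" if "A \<in> sets (borel_on X)" for A
    using measurable_sets[OF mk that] by simp
  have em: "emeasure ?\<nu> A = emeasure \<mu> (h -` A \<inter> topspace X)" if "A \<in> sets (borel_on X)" for A
    using emeasure_distr[OF mh that] space\<mu> by simp
  have hkA: "h -` (k -` A \<inter> topspace X) \<inter> topspace X = A" if "A \<subseteq> topspace X" for A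
    using that kh hX by auto
  \<comment> \<open>Direct images under \<open>h\<close> are preimages under the continuous inverse
    \<open>k\<close>; this is why images of Borel sets are Borel.\<close>
  have khA: "k -` A \<inter> topspace X = h ` A" if "A \<subseteq> topspace X" for A
    using that kh hX hk' by (auto simp: image_iff) metis
  have hA: "h -` A \<inter> topspace X \<in> sets \<mu>" if "A \<in> sets (borel_on X)" for A
    using measurable_sets[OF mh that] space\<mu> by simp
  have inner: "emeasure ?\<nu> A = (SUP K\<in>{K. K \<in> sets ?\<nu> \<and> compactin X K \<and> K \<subseteq> A}. emeasure ?\<nu> K)"
    if A: "A \<in> sets (borel_on X)" for A
  proof (rule antisym)
    have "emeasure ?\<nu> A = (SUP K\<in>{K. K \<in> sets \<mu> \<and> compactin X K \<and> K \<subseteq> h -` A \<inter> topspace X}. emeasure \<mu> K)"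
      using reg hA[OF A] em[OF A] unfolding regular_measure_def by metis
    also have "\<dots> \<le> (SUP K\<in>{K. K \<in> sets ?\<nu> \<and> compactin X K \<and> K \<subseteq> A}. emeasure ?\<nu> K)"
    proof (rule SUP_least)
      fix K assume K: "K \<in> {K. K \<in> sets \<mu> \<and> compactin X K \<and> K \<subseteq> h -` A \<inter> topspace X}"
      then have KX: "K \<subseteq> topspace X" by blast
      have "k -` K \<inter> topspace X \<in> sets (borel_on X)" using pre K sets\<mu> by blast
      then have s: "h ` K \<in> sets (borel_on X)" using khA[OF KX] by simp
      have "compactin X (h ` K)" using K image_compactin ch by blast
      then have mem: "h ` K \<in> {K. K \<in> sets ?\<nu> \<and> compactin X K \<and> K \<subseteq> A}" using K s by auto
      have "emeasure \<mu> K = emeasure ?\<nu> (h ` K)"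
        using em[OF s] hkA[OF KX] khA[OF KX] by simp
      also have "\<dots> \<le> (SUP K\<in>{K. K \<in> sets ?\<nu> \<and> compactin X K \<and> K \<subseteq> A}. emeasure ?\<nu> K)"
        by (rule SUP_upper[OF mem])
      finally show "emeasure \<mu> K \<le> (SUP K\<in>{K. K \<in> sets ?\<nu> \<and> compactin X K \<and> K \<subseteq> A}. emeasure ?\<nu> K)" .
    qed
    finally show "emeasure ?\<nu> A \<le> (SUP K\<in>{K. K \<in> sets ?\<nu> \<and> compactin X K \<and> K \<subseteq> A}. emeasure ?\<nu> K)" .
    show "(SUP K\<in>{K. K \<in> sets ?\<nu> \<and> compactin X K \<and> K \<subseteq> A}. emeasure ?\<nu> K) \<le> emeasure ?\<nu> A"
      by (rule SUP_least, rule emeasure_mono) (use A in simp_all)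
  qed
  have outer: "emeasure ?\<nu> A = (INF U\<in>{U. openin X U \<and> A \<subseteq> U}. emeasure ?\<nu> U)"
    if A: "A \<in> sets (borel_on X)" for A
  proof (rule antisym)
    have "(INF U\<in>{U. openin X U \<and> A \<subseteq> U}. emeasure ?\<nu> U)
        \<le> (INF U\<in>{U. openin X U \<and> h -` A \<inter> topspace X \<subseteq> U}. emeasure \<mu> U)"
    proof (rule INF_greatest)
      fix U assume U: "U \<in> {U. openin X U \<and> h -` A \<inter> topspace X \<subseteq> U}"
      then have UX: "U \<subseteq> topspace X" using openin_subset by blast
      have "openin X (h ` U)" using U h homeomorphic_map_openness_eq by blast
      moreover have "A \<subseteq> h ` U"
      proof
        fix x assume x: "x \<in> A"
        then have "x \<in> topspace X" using sets.sets_into_space[OF A] by auto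
        then have "k x \<in> h -` A \<inter> topspace X" "h (k x) = x" using x hk' kX by auto
        with U show "x \<in> h ` U" by (metis (mono_tags, lifting) image_iff mem_Collect_eq subsetD)
      qed
      ultimately have mem: "h ` U \<in> {U. openin X U \<and> A \<subseteq> U}" by simp
      have "(INF U\<in>{U. openin X U \<and> A \<subseteq> U}. emeasure ?\<nu> U) \<le> emeasure ?\<nu> (h ` U)"
        by (rule INF_lower[OF mem])
      also have "\<dots> = emeasure \<mu> U"
        using em[OF openin_in_borel_on] mem hkA[OF UX] khA[OF UX] by simp
      finally show "(INF U\<in>{U. openin X U \<and> A \<subseteq> U}. emeasure ?\<nu> U) \<le> emeasure \<mu> U" .
    qed
    also have "\<dots> = emeasure ?\<nu> A"
      using reg hA[OF A] em[OF A] unfolding regular_measure_def by metis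
    finally show "(INF U\<in>{U. openin X U \<and> A \<subseteq> U}. emeasure ?\<nu> U) \<le> emeasure ?\<nu> A" .
    show "emeasure ?\<nu> A \<le> (INF U\<in>{U. openin X U \<and> A \<subseteq> U}. emeasure ?\<nu> U)"
      by (rule INF_greatest, rule emeasure_mono) (simp_all add: openin_in_borel_on)
  qed
  have "regular_measure X ?\<nu>"
    unfolding regular_measure_def sets_distr
    by (intro ballI conjI inner[unfolded sets_distr] outer)
  moreover have "prob_space ?\<nu>"
    using \<open>prob_space \<mu>\<close> mh by (rule prob_space.prob_space_distr)
  ultimately show ?thesis
    by (simp add: Prob_def)
qed

section \<open>Integrals against translated measures\<close>

lemma integral_push_action:
  assumes "continuous_map X X (\<phi> g)" "continuous_map X euclideanreal f" "\<mu> \<in> Prob X"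
  shows "(\<integral>x. f x \<partial>push_action X \<phi> g \<mu>) = (\<integral>x. f (\<phi> g x) \<partial>\<mu>)"
proof -
  have "sets \<mu> = sets (borel_on X)" using assms(3) by (simp add: Prob_def)
  then have "\<phi> g \<in> \<mu> \<rightarrow>\<^sub>M borel_on X"
    using continuous_map_measurable_borel_on[OF assms(1)] measurable_cong_sets by blast
  then show ?thesis
    using assms(3) continuous_map_borel_measurable[OF assms(2)]
    by (simp add: push_action_def integral_distr)
qed

text \<open>Lets strong proximality speak about points: integrating against a translated Dirac
  measure evaluates \<open>f\<close> along the orbit of \<open>p\<close>.\<close>

lemma integral_push_return:
  assumes "continuous_map X X (\<phi> g)" "continuous_map X euclideanreal f"
    "Hausdorff_space X" "p \<in> topspace X"
  shows "(\<integral>x. f x \<partial>push_action X \<phi> g (return (borel_on X) p)) = f (\<phi> g p)"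
proof -
  have "(\<lambda>x. f (\<phi> g x)) \<in> borel_measurable (borel_on X)"
    using continuous_map_compose[OF assms(1,2)] continuous_map_borel_measurable
    by (fastforce simp: o_def)
  then show ?thesis
    using integral_push_action[of X \<phi> g f, OF assms(1,2) return_in_Prob[OF assms(3,4)]] assms(4)
    by (simp add: integral_return)
qed


section \<open>Actions\<close>

lemma compact_actionD:
  assumes "compact_action G X \<phi>"
  shows "compact_space X" "Hausdorff_space X" "topspace X \<noteq> {}" "group G"
    "\<And>g. g \<in> carrier G \<Longrightarrow> homeomorphic_map X X (\<phi> g)"
    "\<And>g. g \<in> carrier G \<Longrightarrow> continuous_map X X (\<phi> g)"
    "\<And>g x. g \<in> carrier G \<Longrightarrow> x \<in> topspace X \<Longrightarrow> \<phi> g x \<in> topspace X"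
    "\<And>g h x. g \<in> carrier G \<Longrightarrow> h \<in> carrier G \<Longrightarrow> x \<in> topspace X \<Longrightarrow> \<phi> (g \<otimes>\<^bsub>G\<^esub> h) x = \<phi> g (\<phi> h x)"
    "\<And>x. x \<in> topspace X \<Longrightarrow> \<phi> \<one>\<^bsub>G\<^esub> x = x"
proof -
  interpret group_action G "topspace X" \<phi> using assms by (simp add: compact_action_def)
  show "group G" using group_hom unfolding group_hom_def by blast
  show h: "homeomorphic_map X X (\<phi> g)" if "g \<in> carrier G" for g
    using assms that by (simp add: compact_action_def)
  show c: "continuous_map X X (\<phi> g)" if "g \<in> carrier G" for g
    using h that homeomorphic_imp_continuous_map by blast
  show "\<phi> g x \<in> topspace X" if "g \<in> carrier G" "x \<in> topspace X" for g x
    using c that by (auto simp: continuous_map_def)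
  show "\<phi> (g \<otimes>\<^bsub>G\<^esub> h) x = \<phi> g (\<phi> h x)"
    if "g \<in> carrier G" "h \<in> carrier G" "x \<in> topspace X" for g h x
    using composition_rule that by blast
  show "\<phi> \<one>\<^bsub>G\<^esub> x = x" if "x \<in> topspace X" for x
    using id_eq_one that by (metis restrict_apply')
qed (use assms in \<open>auto simp: compact_action_def\<close>)

lemma compact_space_subcover:
  assumes "compact_space X" "\<And>i. i \<in> I \<Longrightarrow> openin X (U i)" "topspace X \<subseteq> (\<Union>i\<in>I. U i)"
  obtains J where "finite J" "J \<subseteq> I" "topspace X \<subseteq> (\<Union>i\<in>J. U i)"
proof -
  have "compactin X (topspace X)" using assms(1) by (simp add: compact_space_def)
  moreover have "\<And>V. V \<in> U ` I \<Longrightarrow> openin X V" using assms(2) by blast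
  ultimately have "\<exists>\<F>. finite \<F> \<and> \<F> \<subseteq> U ` I \<and> topspace X \<subseteq> \<Union>\<F>"
    using assms(3) by (intro compactinD) auto
  then show ?thesis using that by (metis finite_subset_image)
qed

text \<open>If \<open>s n\<close> moves every point to \<open>p\<close>, then
  \<open>f (\<psi> (s n) y)\<close> tends to \<open>f p\<close> for each continuous
  \<open>f\<close>, uniformly bounded by compactness. Dominated convergence, available because
  \<open>s\<close> is a sequence, makes every probability measure tend to the Dirac measure at
  \<open>p\<close>.\<close>

lemma strongly_proximal_if_contracting:
  assumes Y: "compact_action G Y \<psi>" and s: "\<And>n. s n \<in> L" and L: "L \<subseteq> carrier G"
    and p: "p \<in> topspace Y"
    and lim: "\<And>y. y \<in> topspace Y \<Longrightarrow> limitin Y (\<lambda>n. \<psi> (s n) y) p sequentially"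
  shows "strongly_proximal_action (G\<lparr>carrier := L\<rparr>) Y \<psi>"
  unfolding strongly_proximal_action_def proximal_action_def
proof (intro ballI exI conjI)
  note Y' = compact_actionD[OF Y]
  have sG: "s n \<in> carrier G" for n using s L by blast
  \<comment> \<open>The filter \<open>filtermap s sequentially\<close> is the sequence
    \<open>s\<close> seen as a net; filter and limit are the same for all measures, so one choice
    serves every pair.\<close>
  have conv: "limitin (weak_star Y) (\<lambda>g. push_action Y \<psi> g \<mu>) (return (borel_on Y) p) (filtermap s sequentially)"
    if \<mu>: "\<mu> \<in> Prob Y" for \<mu>
    unfolding limitin_weak_star
  proof (intro conjI allI impI)
    show "return (borel_on Y) p \<in> Prob Y" by (rule return_in_Prob[OF Y'(2) p])
    show "\<forall>\<^sub>F g in filtermap s sequentially. push_action Y \<psi> g \<mu> \<in> Prob Y"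
      using distr_in_Prob[OF Y'(5)[OF sG]] \<mu> by (simp add: eventually_filtermap push_action_def)
    fix f assume f: "continuous_map Y euclideanreal f"
    have sets\<mu>: "sets \<mu> = sets (borel_on Y)" and "prob_space \<mu>" using \<mu> by (auto simp: Prob_def)
    interpret prob_space \<mu> by fact
    have space\<mu>: "space \<mu> = topspace Y" using sets_eq_imp_space_eq[OF sets\<mu>] by simp
    have m: "f \<in> borel_measurable \<mu>" if "continuous_map Y euclideanreal f" for f
      using continuous_map_borel_measurable[OF that] measurable_cong_sets[OF sets\<mu> refl] by blast
    have "compact (f ` topspace Y)"
      using Y'(1) f image_compactin by (fastforce simp: compact_space_def)
    then obtain b where b: "\<And>y. y \<in> topspace Y \<Longrightarrow> norm (f y) \<le> b"
      using compact_imp_bounded bounded_iff by (metis imageI)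
    have "(\<lambda>n. \<integral>x. f (\<psi> (s n) x) \<partial>\<mu>) \<longlonglongrightarrow> (\<integral>x. f p \<partial>\<mu>)"
    proof (rule integral_dominated_convergence[where w = "\<lambda>_. b"])
      show "(\<lambda>x. f (\<psi> (s i) x)) \<in> borel_measurable \<mu>" for i
        using m[OF continuous_map_compose[OF Y'(6)[OF sG] f]] by (simp add: o_def)
      show "AE x in \<mu>. (\<lambda>n. f (\<psi> (s n) x)) \<longlonglongrightarrow> f p"
        using continuous_map_limit[OF f lim] by (intro AE_I2) (simp add: o_def space\<mu>)
      show "AE x in \<mu>. norm (f (\<psi> (s i) x)) \<le> b" for i
        using b Y'(7)[OF sG] by (intro AE_I2) (simp add: space\<mu>)
    qed auto
    then show "((\<lambda>g. \<integral>x. f x \<partial>push_action Y \<psi> g \<mu>) \<longlongrightarrow> (\<integral>x. f x \<partial>return (borel_on Y) p))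
        (filtermap s sequentially)"
      using integral_push_action[of Y \<psi> "s n" f \<mu> for n, OF Y'(6)[OF sG] f \<mu>] p continuous_map_borel_measurable[OF f]
      by (simp add: filterlim_filtermap integral_return prob_space)
  qed
  show "filtermap s sequentially \<noteq> bot" by (simp add: filtermap_bot_iff)
  show "\<forall>\<^sub>F g in filtermap s sequentially. g \<in> carrier (G\<lparr>carrier := L\<rparr>)"
    using s by (simp add: eventually_filtermap)
  fix \<mu> \<nu> assume "\<mu> \<in> topspace (weak_star Y)" "\<nu> \<in> topspace (weak_star Y)"
  then show "limitin (weak_star Y) (\<lambda>g. push_action Y \<psi> g \<mu>) (return (borel_on Y) p) (filtermap s sequentially)"
    "limitin (weak_star Y) (\<lambda>g. push_action Y \<psi> g \<nu>) (return (borel_on Y) p) (filtermap s sequentially)"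
    using conv by (simp_all only: topspace_weak_star)
qed

text \<open>If \<open>g\<^sub>i x\<close> and \<open>g\<^sub>i t x = t g\<^sub>i x\<close> have the same limit \<open>z\<close>, then \<open>t z = z\<close>. Passing to a
  convergent subnet is replaced by a covering argument with Urysohn functions.\<close>
lemma strongly_proximal_centralizer_fixed_point:
  assumes X: "compact_action G X \<phi>" and sp: "strongly_proximal_action (G\<lparr>carrier := L\<rparr>) X \<phi>"
    and L: "L \<subseteq> carrier G" and t: "t \<in> carrier G" and comm: "\<And>g. g \<in> L \<Longrightarrow> g \<otimes>\<^bsub>G\<^esub> t = t \<otimes>\<^bsub>G\<^esub> g"
  shows "\<exists>z\<in>topspace X. \<phi> t z = z"
proof (rule ccontr)
  assume no: "\<not> (\<exists>z\<in>topspace X. \<phi> t z = z)"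
  note X' = compact_actionD[OF X]
  obtain x where x: "x \<in> topspace X" using X'(3) by blast
  have tx: "\<phi> t x \<in> topspace X" using X'(7) t x by blast
  let ?\<delta> = "\<lambda>x. return (borel_on X) x"
  \<comment> \<open>Strong proximality is applied to the Dirac measures at \<open>x\<close> and
    \<open>\<phi> t x\<close>. The common limit is only known to be a probability measure, so no
    limit point in \<open>X\<close> is at hand yet.\<close>
  obtain F \<nu> where F: "F \<noteq> bot" "\<forall>\<^sub>F g in F. g \<in> L"
    and lim: "limitin (weak_star X) (\<lambda>g. push_action X \<phi> g (?\<delta> x)) \<nu> F"
      "limitin (weak_star X) (\<lambda>g. push_action X \<phi> g (?\<delta> (\<phi> t x))) \<nu> F"
    using sp return_in_Prob[OF X'(2) x] return_in_Prob[OF X'(2) tx]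
    unfolding strongly_proximal_action_def proximal_action_def by force
  \<comment> \<open>The two integrals have the same limit, and by commutation
    \<open>\<phi> g (\<phi> t x)\<close> equals \<open>\<phi> t (\<phi> g x)\<close>. The bound 1/3
    only has to lie below the gap 1 of the Urysohn functions used next.\<close>
  have ev: "\<forall>\<^sub>F g in F. \<bar>f (\<phi> g x) - f (\<phi> t (\<phi> g x))\<bar> < 1/3"
    if f: "continuous_map X euclideanreal f" for f
  proof -
    let ?i = "\<lambda>y g. \<integral>x. f x \<partial>push_action X \<phi> g (?\<delta> y)"
    have "((\<lambda>g. ?i x g - ?i (\<phi> t x) g) \<longlongrightarrow> (\<integral>x. f x \<partial>\<nu>) - (\<integral>x. f x \<partial>\<nu>)) F"
      using lim f unfolding limitin_weak_star by (intro tendsto_diff) auto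
    then have "((\<lambda>g. ?i x g - ?i (\<phi> t x) g) \<longlongrightarrow> 0) F" by simp
    then have "\<forall>\<^sub>F g in F. dist (?i x g - ?i (\<phi> t x) g) 0 < 1/3"
      by (rule tendstoD) simp
    with F(2) show ?thesis
    proof eventually_elim
      case (elim g)
      then have g: "g \<in> carrier G" using L by blast
      have "\<phi> g (\<phi> t x) = \<phi> t (\<phi> g x)"
        using X'(8)[OF g t x] X'(8)[OF t g x] comm elim(1) by simp
      then show ?case
        using elim(2) integral_push_return[of X \<phi> g f, OF X'(6)[OF g] f X'(2)] x tx by simp
    qed
  qed
  \<comment> \<open>Without fixed points, a Urysohn function is 0 at \<open>z\<close> and 1 at
    \<open>\<phi> t z\<close>; the difference is -1 at \<open>z\<close>, so it stays below -1/3 on a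
    neighbourhood.\<close>
  have "\<exists>f U. continuous_map X euclideanreal f \<and> openin X U \<and> z \<in> U \<and>
      (\<forall>y\<in>U. \<bar>f y - f (\<phi> t y)\<bar> \<ge> 1/3)" if z: "z \<in> topspace X" for z
  proof -
    have tz: "\<phi> t z \<in> topspace X" "\<phi> t z \<noteq> z" using no z X'(7) t by auto
    have "closedin X {z}" "closedin X {\<phi> t z}"
      using X'(2) z tz closedin_Hausdorff_singleton by metis+
    moreover have "normal_space X"
      using X'(1,2) by (simp add: compact_Hausdorff_or_regular_imp_normal_space)
    ultimately obtain f :: "_ \<Rightarrow> real" where
      f0: "continuous_map X (top_of_set {0..1}) f" "f ` {z} \<subseteq> {0}" "f ` {\<phi> t z} \<subseteq> {1}"
      using Urysohn_lemma[of X "{z}" "{\<phi> t z}" 0 1] tz by (auto simp: disjnt_def)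
    then have f: "continuous_map X euclideanreal f" "f z = 0" "f (\<phi> t z) = 1"
      by (auto simp: continuous_map_in_subtopology)
    have "continuous_map X euclideanreal (\<lambda>y. f y - f (\<phi> t y))"
      using continuous_map_compose[OF X'(6)[OF t] f(1)]
      by (intro continuous_map_diff f(1)) (simp add: o_def)
    from openin_continuous_map_preimage[OF this, of "{..<-1/3}"]
    have "openin X {y \<in> topspace X. f y - f (\<phi> t y) \<in> {..<-1/3}}"
      by (simp add: open_openin[symmetric])
    then show ?thesis using f z
      by (intro exI[of _ f] exI[of _ "{y \<in> topspace X. f y - f (\<phi> t y) \<in> {..<-1/3}}"]) auto
  qed
  then obtain f U where fU: "\<And>z. z \<in> topspace X \<Longrightarrow> continuous_map X euclideanreal (f z) \<and>
      openin X (U z) \<and> z \<in> U z \<and> (\<forall>y\<in>U z. \<bar>f z y - f z (\<phi> t y)\<bar> \<ge> 1/3)"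
    by metis
  obtain Z where Z: "finite Z" "Z \<subseteq> topspace X" "topspace X \<subseteq> \<Union>(U ` Z)"
    by (rule compact_space_subcover[OF X'(1), of "topspace X" U]) (use fU in auto)
  \<comment> \<open>Finitely many conditions hold at once for some \<open>g\<close>; the point
    \<open>\<phi> g x\<close> then lies in some \<open>U z\<close> with \<open>z \<in> Z\<close> and
    violates the bound there.\<close>
  have "\<forall>\<^sub>F g in F. \<forall>z\<in>Z. \<bar>f z (\<phi> g x) - f z (\<phi> t (\<phi> g x))\<bar> < 1/3"
    using Z ev fU by (intro eventually_ball_finite) auto
  with F have "\<exists>g. g \<in> L \<and> (\<forall>z\<in>Z. \<bar>f z (\<phi> g x) - f z (\<phi> t (\<phi> g x))\<bar> < 1/3)"
    using eventually_happens[OF eventually_conj] by blast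
  then obtain g where g: "g \<in> L" "\<And>z. z \<in> Z \<Longrightarrow> \<bar>f z (\<phi> g x) - f z (\<phi> t (\<phi> g x))\<bar> < 1/3"
    by blast
  have "\<phi> g x \<in> topspace X" using X'(7) g(1) L x by blast
  then obtain z where "z \<in> Z" "\<phi> g x \<in> U z" using Z by blast
  then show False using g(2) fU Z(2) by fastforce
qed

text \<open>Finitely many translates of a nonempty open set cover a minimal compact space.\<close>
lemma topologically_free_if_finite_fixed_points:
  assumes X: "compact_action G X \<phi>" and min: "minimal_action G X \<phi>"
    and \<pi>: "\<pi> ` topspace X = Y" "infinite Y"
    and equiv: "\<And>g x. g \<in> carrier G \<Longrightarrow> x \<in> topspace X \<Longrightarrow> \<pi> (\<phi> g x) = \<psi> g (\<pi> x)"
    and fin: "\<And>g. g \<in> carrier G - {\<one>\<^bsub>G\<^esub>} \<Longrightarrow> finite {y \<in> Y. \<psi> g y = y}"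
  shows "topologically_free_action G X \<phi>"
  unfolding topologically_free_action_def
proof (intro ballI, rule ccontr)
  note X' = compact_actionD[OF X]
  interpret group G by (rule X')
  fix g assume g: "g \<in> carrier G - {\<one>\<^bsub>G\<^esub>}"
  define U where "U = X interior_of {x \<in> topspace X. \<phi> g x = x}"
  assume "X interior_of {x \<in> topspace X. \<phi> g x = x} \<noteq> {}"
  then obtain u where u: "u \<in> U" by (auto simp: U_def)
  have U: "openin X U" "U \<subseteq> {x \<in> topspace X. \<phi> g x = x}"
    by (simp_all add: U_def interior_of_subset)
  have UX: "U \<subseteq> topspace X" using U by blast
  \<comment> \<open>The union of all translates of \<open>U\<close>. Its complement is closed and
    invariant and misses \<open>u\<close>, so minimality makes it empty.\<close>
  define W where "W = (\<Union>h\<in>carrier G. \<phi> h ` U)"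
  have op: "openin X (\<phi> h ` U)" if "h \<in> carrier G" for h
    using X'(5)[OF that] U(1) homeomorphic_map_openness_eq by blast
  have "closedin X (topspace X - W)" unfolding W_def using op by blast
  moreover have "\<phi> h ` (topspace X - W) \<subseteq> topspace X - W" if h: "h \<in> carrier G" for h
  proof clarify
    fix x assume x: "x \<in> topspace X" "x \<notin> W"
    have "\<phi> h x \<notin> W"
    proof
      assume "\<phi> h x \<in> W"
      then obtain k y where k: "k \<in> carrier G" "y \<in> U" "\<phi> h x = \<phi> k y" unfolding W_def by blast
      have y: "y \<in> topspace X" using k UX by blast
      have "x = \<phi> (inv\<^bsub>G\<^esub> h \<otimes>\<^bsub>G\<^esub> h) x" using h X'(9)[OF x(1)] by simp
      also have "\<dots> = \<phi> (inv\<^bsub>G\<^esub> h \<otimes>\<^bsub>G\<^esub> k) y"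
        using X'(8)[of "inv\<^bsub>G\<^esub> h" h x] X'(8)[of "inv\<^bsub>G\<^esub> h" k y] h k x y by simp
      finally have "x \<in> W" using h k unfolding W_def by blast
      with x show False by blast
    qed
    then show "\<phi> h x \<in> topspace X - W" using X'(7)[OF h x(1)] by blast
  qed
  ultimately have "topspace X - W = {} \<or> topspace X - W = topspace X"
    using min unfolding minimal_action_def by blast
  moreover have "u \<in> W" "u \<in> topspace X"
    using u UX X'(9) one_closed unfolding W_def by force+
  ultimately have "topspace X \<subseteq> W" by blast
  then have WX: "topspace X \<subseteq> (\<Union>h\<in>carrier G. \<phi> h ` U)" unfolding W_def .
  obtain H where H: "finite H" "H \<subseteq> carrier G" "topspace X \<subseteq> (\<Union>h\<in>H. \<phi> h ` U)"
    using compact_space_subcover[OF X'(1) op WX] by metis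
  \<comment> \<open>By equivariance points fixed by \<open>g\<close> map to points fixed by
    \<open>g\<close>, so \<open>U\<close> has finite image; finitely many translates of this image
    then exhaust the infinite set \<open>Y\<close>.\<close>
  have "\<pi> ` U \<subseteq> {y \<in> Y. \<psi> g y = y}"
  proof clarify
    fix x assume "x \<in> U"
    then have "x \<in> topspace X" "\<phi> g x = x" using U by auto
    then show "\<pi> x \<in> Y \<and> \<psi> g (\<pi> x) = \<pi> x" using \<pi>(1) equiv[of g x] g by auto
  qed
  then have finU: "finite (\<pi> ` U)" using fin[OF g] finite_subset by blast
  have "Y \<subseteq> (\<Union>h\<in>H. \<psi> h ` \<pi> ` U)"
  proof
    fix y assume "y \<in> Y"
    then obtain x where "x \<in> topspace X" "y = \<pi> x" using \<pi> by blast
    with H(3) obtain h v where hv: "h \<in> H" "v \<in> U" "y = \<pi> (\<phi> h v)" by blast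
    have "y = \<psi> h (\<pi> v)" using hv equiv[of h v] H(2) UX by (simp add: subset_iff)
    with hv show "y \<in> (\<Union>h\<in>H. \<psi> h ` \<pi> ` U)" by blast
  qed
  moreover have "finite (\<Union>h\<in>H. \<psi> h ` \<pi> ` U)" using H(1) finU by simp
  ultimately show False using \<pi>(2) finite_subset by metis
qed

text \<open>Frolik: a maximal open \<open>U\<close> disjoint from \<open>h U\<close> is clopen, and the complement of the fixed
  point set is \<open>U \<union> h U \<union> h\<^sup>-\<^sup>1 U\<close>.\<close>
lemma extremally_disconnected_openin_fixed_points:
  assumes X: "Hausdorff_space X" "extremally_disconnected X" and h: "homeomorphic_map X X h"
  shows "openin X {x \<in> topspace X. h x = x}"
proof -
  obtain k where hk: "homeomorphic_maps X X h k" using h homeomorphic_map_maps by metis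
  then have ch: "continuous_map X X h"
    and kh: "\<And>x. x \<in> topspace X \<Longrightarrow> k (h x) = x"
    by (auto simp: homeomorphic_maps_def)
  have hX: "\<And>x. x \<in> topspace X \<Longrightarrow> h x \<in> topspace X"
    using ch by (auto simp: continuous_map_def)
  define \<A> where "\<A> = {U. openin X U \<and> U \<inter> h ` U = {}}"
  have "\<exists>U\<in>\<A>. \<forall>V\<in>\<A>. U \<subseteq> V \<longrightarrow> V = U"
  proof (rule subset_Zorn_nonempty)
    show "\<A> \<noteq> {}" by (auto simp: \<A>_def)
    fix \<C> assume \<C>: "\<C> \<noteq> {}" "subset.chain \<A> \<C>"
    then have sub: "\<C> \<subseteq> \<A>" and lin: "\<And>U V. U \<in> \<C> \<Longrightarrow> V \<in> \<C> \<Longrightarrow> U \<subseteq> V \<or> V \<subseteq> U"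
      by (auto simp: subset_chain_def)
    \<comment> \<open>Two members of the chain are comparable, so the larger one already gives the
      disjointness.\<close>
    have "h y \<notin> U" if UV: "U \<in> \<C>" "V \<in> \<C>" and y: "y \<in> V" for y U V
    proof -
      have "U \<in> \<A>" "V \<in> \<A>" using UV sub by auto
      then have "U \<inter> h ` U = {}" "V \<inter> h ` V = {}" by (simp_all add: \<A>_def)
      with lin[OF UV] y show ?thesis by auto
    qed
    then have "\<Union>\<C> \<inter> h ` \<Union>\<C> = {}" by auto
    moreover have "openin X (\<Union>\<C>)" by (rule openin_Union) (use sub in \<open>auto simp: \<A>_def\<close>)
    ultimately show "\<Union>\<C> \<in> \<A>" by (simp add: \<A>_def)
  qed
  then obtain U where UA: "U \<in> \<A>" and maxA: "\<And>V. V \<in> \<A> \<Longrightarrow> U \<subseteq> V \<Longrightarrow> V = U"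
    by blast
  from UA have U: "openin X U" "U \<inter> h ` U = {}" unfolding \<A>_def by blast+
  have max: "V = U" if "openin X V" "V \<inter> h ` V = {}" "U \<subseteq> V" for V
    by (rule maxA) (use that in \<open>simp_all add: \<A>_def\<close>)
  have UX: "U \<subseteq> topspace X" using U(1) openin_subset by blast
  define C where "C = X closure_of U"
  \<comment> \<open>Here extremal disconnectedness enters. An open set that misses a set misses its
    closure; this is used first for the open set \<open>h\<close>
    U\<open>against\<close>U\<open>, then for the open set\<close>C\<open>against\<close>h
    \<open>U\<close>, so \<open>C\<close> is again disjoint from its image.\<close>
  have C: "openin X C" using X(2) U(1) by (simp add: extremally_disconnected_def C_def)
  have "openin X (h ` U)" using U(1) h homeomorphic_map_openness_eq by blast
  then have "h ` U \<inter> C = {}"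
    using U(2) openin_Int_closure_of_eq_empty unfolding C_def by blast
  then have "C \<inter> X closure_of (h ` U) = {}"
    using C openin_Int_closure_of_eq_empty by blast
  then have "C \<inter> h ` C = {}"
    using homeomorphic_map_closure_of[OF h UX] by (simp add: C_def)
  then have "C = U" using max C closure_of_subset[OF UX] C_def by blast
  then have cU: "closedin X U" using closedin_closure_of C_def by metis
  \<comment> \<open>The candidate for the fixed point set. It is open because the three sets removed
    are closed.\<close>
  define N where "N = topspace X - (U \<union> h ` U \<union> {x \<in> topspace X. h x \<in> U})"
  have "closedin X (h ` U)" using cU h UX homeomorphic_map_closedness_eq by blast
  moreover have "closedin X {x \<in> topspace X. h x \<in> U}"
    using closedin_continuous_map_preimage[OF ch cU] .
  ultimately have N: "openin X N" unfolding N_def using cU by blast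
  have "{x \<in> topspace X. h x = x} \<subseteq> N"
  proof clarify
    fix x assume x: "x \<in> topspace X" "h x = x"
    then have "x \<notin> U" using U(2) by (metis disjoint_iff imageI)
    moreover have "x \<notin> h ` U"
    proof
      assume "x \<in> h ` U"
      then obtain y where "y \<in> U" "h y = h x" using x by auto
      then show False using kh[of x] kh[of y] x UX \<open>x \<notin> U\<close> by auto
    qed
    ultimately show "x \<in> N" using x by (simp add: N_def)
  qed
  moreover have "h x = x" if x: "x \<in> N" for x
  proof (rule ccontr)
    assume ne: "h x \<noteq> x"
    have xX: "x \<in> topspace X" using x by (simp add: N_def)
    then obtain V1 V2 where V: "openin X V1" "openin X V2" "x \<in> V1" "h x \<in> V2" "disjnt V1 V2"
      using X(1) ne hX[OF xX] unfolding Hausdorff_space_def by metis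
    define V where "V = V1 \<inter> N \<inter> {y \<in> topspace X. h y \<in> V2}"
    have "openin X V"
      unfolding V_def using V N openin_continuous_map_preimage[OF ch V(2)] by blast
    moreover have "h y \<notin> U \<union> V" if "y \<in> U \<union> V" for y
      using that
    proof
      assume y: "y \<in> U"
      then have "h y \<notin> V" by (simp add: V_def N_def)
      with y U(2) show ?thesis by blast
    next
      assume y: "y \<in> V"
      then have "h y \<notin> V1" using V(5) by (auto simp: V_def disjnt_def)
      with y show ?thesis by (auto simp: V_def N_def)
    qed
    ultimately have "U \<union> V = U" using max[of "U \<union> V"] U(1) by blast
    moreover have "x \<in> V" using V x xX by (simp add: V_def)
    ultimately show False using x by (auto simp: N_def)
  qed
  moreover have "N \<subseteq> topspace X" by (simp add: N_def)
  ultimately have "{x \<in> topspace X. h x = x} = N" by blast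
  with N show ?thesis by simp
qed

text \<open>The inverse group element supplies a continuous inverse, so continuity of each
  \<open>\<phi> g\<close> is enough. Extensionality yields the homomorphism law as an equality of
  functions, also outside the space.\<close>

lemma compact_actionI:
  assumes X: "compact_space X" "Hausdorff_space X" "topspace X \<noteq> {}" and G: "group G"
    and ext: "\<And>g. g \<in> carrier G \<Longrightarrow> \<phi> g \<in> extensional (topspace X)"
    and cont: "\<And>g. g \<in> carrier G \<Longrightarrow> continuous_map X X (\<phi> g)"
    and mult: "\<And>g h x. g \<in> carrier G \<Longrightarrow> h \<in> carrier G \<Longrightarrow> x \<in> topspace X \<Longrightarrow>
      \<phi> (g \<otimes>\<^bsub>G\<^esub> h) x = \<phi> g (\<phi> h x)"
    and one: "\<And>x. x \<in> topspace X \<Longrightarrow> \<phi> \<one>\<^bsub>G\<^esub> x = x"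
  shows "compact_action G X \<phi>"
proof -
  interpret group G by (rule G)
  have maps: "homeomorphic_maps X X (\<phi> g) (\<phi> (inv\<^bsub>G\<^esub> g))" if g: "g \<in> carrier G" for g
    unfolding homeomorphic_maps_def
    using cont g mult[of g "inv\<^bsub>G\<^esub> g"] mult[of "inv\<^bsub>G\<^esub> g" g] one by simp
  then have homeo: "homeomorphic_map X X (\<phi> g)" if "g \<in> carrier G" for g
    using that homeomorphic_map_maps by blast
  have bij: "\<phi> g \<in> Bij (topspace X)" if g: "g \<in> carrier G" for g
    using ext[OF g] homeomorphic_imp_injective_map[OF homeo[OF g]]
      homeomorphic_imp_surjective_map[OF homeo[OF g]]
    by (simp add: Bij_def bij_betw_def)
  have "\<phi> (g \<otimes>\<^bsub>G\<^esub> h) = \<phi> g \<otimes>\<^bsub>BijGroup (topspace X)\<^esub> \<phi> h"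
    if gh: "g \<in> carrier G" "h \<in> carrier G" for g h
  proof
    fix x
    show "\<phi> (g \<otimes>\<^bsub>G\<^esub> h) x = (\<phi> g \<otimes>\<^bsub>BijGroup (topspace X)\<^esub> \<phi> h) x"
      using gh bij mult ext[OF m_closed[OF gh]]
      by (cases "x \<in> topspace X") (auto simp: BijGroup_def compose_def extensional_def)
  qed
  then have "\<phi> \<in> hom G (BijGroup (topspace X))"
    using bij by (auto simp: hom_def BijGroup_def)
  then have "group_action G (topspace X) \<phi>"
    using G group_BijGroup
    by (simp add: group_action_def group_hom_def group_hom_axioms_def)
  with X homeo show ?thesis by (simp add: compact_action_def)
qed

text \<open>The universal property is applied to a copy of \<open>Y\<close> on the type \<open>'g set set\<close>, which exists by
  \<open>minimal_space_embeds\<close>.\<close>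
lemma universal_boundary_contracting:
  fixes G :: "('g, 'm) monoid_scheme" and Y :: "'y topology"
  assumes univ: "universal_boundary G L X \<phi>" and L: "L \<subseteq> carrier G"
    and Y: "compact_action G Y \<psi>" and min: "minimal_action G Y \<psi>"
    and s: "\<And>n. s n \<in> L" and p: "p \<in> topspace Y"
    and lim: "\<And>y. y \<in> topspace Y \<Longrightarrow> limitin Y (\<lambda>n. \<psi> (s n) y) p sequentially"
  shows "\<exists>\<pi>. continuous_map X Y \<pi> \<and> \<pi> ` topspace X = topspace Y \<and>
    (\<forall>g\<in>carrier G. \<forall>x\<in>topspace X. \<pi> (\<phi> g x) = \<psi> g (\<pi> x))"
proof -
  note Y' = compact_actionD[OF Y]
  obtain h :: "'y \<Rightarrow> 'g set set" where inj: "inj_on h (topspace Y)"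
    using minimal_space_embeds[OF Y min] by blast
  define k where "k = inv_into (topspace Y) h"
  have kh: "k (h y) = y" if "y \<in> topspace Y" for y
    using inj that by (simp add: k_def)
  \<comment> \<open>The topology of \<open>Y\<close> transported along the injection
    \<open>h\<close>, so that \<open>h\<close> becomes a homeomorphism with inverse
    \<open>k\<close>.\<close>
  define Z where "Z = pullback_topology (h ` topspace Y) k Y"
  have topZ: "topspace Z = h ` topspace Y"
    using kh by (auto simp: Z_def topspace_pullback_topology)
  have "continuous_map Z Y (id \<circ> k)"
    unfolding Z_def by (rule continuous_map_pullback) simp
  then have ck: "continuous_map Z Y k" by simp
  have "continuous_map Y Z h"
    unfolding Z_def
  proof (rule continuous_map_pullback')
    show "continuous_map Y Y (k \<circ> h)"
      by (rule continuous_map_eq[OF continuous_map_id]) (simp add: kh)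
  qed auto
  with ck have hk: "homeomorphic_maps Y Z h k"
    using kh by (auto simp: homeomorphic_maps_def topZ)
  note ch = \<open>continuous_map Y Z h\<close>
  have hom: "Y homeomorphic_space Z" using hk by (auto simp: homeomorphic_space_def)
  have hkz: "h (k z) = z" "k z \<in> topspace Y" if "z \<in> topspace Z" for z
    using that kh by (auto simp: topZ)
  define \<psi>' where "\<psi>' g = restrict (\<lambda>z. h (\<psi> g (k z))) (topspace Z)" for g
  have \<psi>'h: "\<psi>' g (h y) = h (\<psi> g y)" if "y \<in> topspace Y" for g y
    using that by (simp add: \<psi>'_def topZ kh)
  have Z: "compact_action G Z \<psi>'"
  proof (rule compact_actionI)
    show "compact_space Z" using hom Y'(1) homeomorphic_compact_space by blast
    show "Hausdorff_space Z" using hom Y'(2) homeomorphic_Hausdorff_space by blast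
    show "topspace Z \<noteq> {}" using Y'(3) by (simp add: topZ)
    show "continuous_map Z Z (\<psi>' g)" if "g \<in> carrier G" for g
      by (rule continuous_map_eq[OF continuous_map_compose[OF ck
              continuous_map_compose[OF Y'(6)[OF that] ch]]]) (simp add: \<psi>'_def)
    show "\<psi>' (g \<otimes>\<^bsub>G\<^esub> g') z = \<psi>' g (\<psi>' g' z)"
      if "g \<in> carrier G" "g' \<in> carrier G" "z \<in> topspace Z" for g g' z
      using that Y'(7,8) by (auto simp: topZ \<psi>'h)
    show "\<psi>' \<one>\<^bsub>G\<^esub> z = z" if "z \<in> topspace Z" for z
      using that Y'(9) by (auto simp: topZ \<psi>'h)
  qed (auto simp: \<psi>'_def Y'(4))
  have minZ: "minimal_action G Z \<psi>'"
    unfolding minimal_action_def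
  proof (intro allI impI, elim conjE)
    fix S assume S: "closedin Z S" "\<forall>g\<in>carrier G. \<psi>' g ` S \<subseteq> S"
    define S' where "S' = {y \<in> topspace Y. h y \<in> S}"
    have "closedin Y S'" unfolding S'_def using closedin_continuous_map_preimage[OF ch S(1)] .
    moreover have "\<psi> g ` S' \<subseteq> S'" if "g \<in> carrier G" for g
      using S(2) that Y'(7) \<psi>'h unfolding S'_def by (force simp: image_subset_iff)
    ultimately have "S' = {} \<or> S' = topspace Y" using min unfolding minimal_action_def by blast
    moreover have "S = h ` S'" using closedin_subset[OF S(1)] by (auto simp: S'_def topZ)
    ultimately show "S = {} \<or> S = topspace Z" by (auto simp: topZ)
  qed
  have hp: "h p \<in> topspace Z" using p by (simp add: topZ)
  have limZ: "limitin Z (\<lambda>n. \<psi>' (s n) z) (h p) sequentially" if z: "z \<in> topspace Z" for z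
    using continuous_map_limit[OF ch lim[OF hkz(2)[OF z]]] z by (simp add: o_def \<psi>'_def)
  have sL: "strongly_proximal_action (G\<lparr>carrier := L\<rparr>) Z \<psi>'"
    by (rule strongly_proximal_if_contracting[OF Z s L hp limZ])
  \<comment> \<open>The same contracting sequence, now read in the whole group, also gives strong
    proximality for \<open>G\<close>.\<close>
  have "s n \<in> carrier G" for n using s L by blast
  from strongly_proximal_if_contracting[OF Z this subset_refl hp limZ]
  have "boundary_action G Z \<psi>'" using Z minZ by (simp add: boundary_action_def)
  with sL obtain f where f: "continuous_map X Z f" "f ` topspace X = topspace Z"
    and equiv: "\<forall>g\<in>carrier G. \<forall>x\<in>topspace X. f (\<phi> g x) = \<psi>' g (f x)"
    using univ unfolding universal_boundary_def by metis
  have fz: "f x \<in> topspace Z" if "x \<in> topspace X" for x using f(2) that by blast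
  have "k ` f ` topspace X = topspace Y" unfolding f(2) topZ using kh by (force simp: image_iff)
  moreover have "k (f (\<phi> g x)) = \<psi> g (k (f x))" if "g \<in> carrier G" "x \<in> topspace X" for g x
    using equiv that fz[OF that(2)] hkz Y'(7)[OF that(1)] by (simp add: \<psi>'_def kh)
  ultimately show ?thesis
    using continuous_map_compose[OF f(1) ck] by (intro exI[of _ "k \<circ> f"]) (auto simp: image_comp)
qed


section \<open>The projective line as a circle\<close>

text \<open>The line through \<open>z\<close> is represented by \<open>z / cnj z\<close>. A real matrix acts on the plane as
  \<open>z \<mapsto> \<alpha> z + \<beta> (cnj z)\<close>, hence on the circle as \<open>w \<mapsto> (\<alpha> w + \<beta>) / (cnj \<beta> w + cnj \<alpha>)\<close>. The point
  at infinity, that is the line through \<open>1\<close>, becomes \<open>1\<close>.\<close>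

definition circ_alpha :: "int^2^2 \<Rightarrow> complex"
  where "circ_alpha A = Complex ((A$1$1 + A$2$2) / 2) ((A$2$1 - A$1$2) / 2)"

definition circ_beta :: "int^2^2 \<Rightarrow> complex"
  where "circ_beta A = Complex ((A$1$1 - A$2$2) / 2) ((A$1$2 + A$2$1) / 2)"

definition circ_map :: "int^2^2 \<Rightarrow> complex \<Rightarrow> complex"
  where "circ_map A w =
    (circ_alpha A * w + circ_beta A) / (cnj (circ_beta A) * w + cnj (circ_alpha A))"

definition circ_action :: "(int^2^2) set \<Rightarrow> complex \<Rightarrow> complex"
  where "circ_action C = (\<lambda>w\<in>sphere 0 1. the_elem ((\<lambda>A. circ_map A w) ` C))"

lemma circ_minus [simp]: "circ_alpha (- A) = - circ_alpha A" "circ_beta (- A) = - circ_beta A"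
  by (simp_all add: circ_alpha_def circ_beta_def complex_eq_iff field_simps)

lemma circ_map_minus [simp]: "circ_map (- A) w = circ_map A w"
proof -
  have "circ_map (- A) w = - (circ_alpha A * w + circ_beta A) /
      - (cnj (circ_beta A) * w + cnj (circ_alpha A))"
    by (simp add: circ_map_def)
  then show ?thesis unfolding circ_map_def minus_divide_divide .
qed

lemma circ_action_eq: "w \<in> sphere 0 1 \<Longrightarrow> circ_action {A, - A} w = circ_map A w"
  by (simp add: circ_action_def)

text \<open>This is the determinant of the real-linear map
  \<open>z \<mapsto> \<alpha> z + \<beta> (cnj z)\<close>. Determinant 1 thus puts the matrix with
  rows \<open>(\<alpha>, \<beta>)\<close> and \<open>(cnj \<beta>, cnj \<alpha>)\<close> into
  SU(1,1).\<close>

lemma cmod_circ: "(cmod (circ_alpha A))\<^sup>2 - (cmod (circ_beta A))\<^sup>2 = det A"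
  unfolding cmod_power2
  by (simp add: circ_alpha_def circ_beta_def det_2 power2_eq_square field_simps)

text \<open>The composition rule for maps of the form
  \<open>z \<mapsto> \<alpha> z + \<beta> (cnj z)\<close>.\<close>

lemma circ_mult:
  "circ_alpha (A ** B) = circ_alpha A * circ_alpha B + circ_beta A * cnj (circ_beta B)"
  "circ_beta (A ** B) = circ_alpha A * circ_beta B + circ_beta A * cnj (circ_alpha B)"
  by (simp_all add: circ_alpha_def circ_beta_def complex_eq_iff matrix_matrix_mult_def sum_2
      field_simps)

lemma cnj_sphere: "w \<in> sphere 0 1 \<Longrightarrow> cnj w * w = 1"
  using complex_norm_square[of w] by (simp add: mult.commute)

text \<open>On the unit circle a zero would force \<alpha> and \<beta> to have equal modulus,
  whereas their squared moduli differ by the determinant 1.\<close>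

lemma circ_denominator:
  assumes "det A = 1" "w \<in> sphere 0 1"
  shows "cnj (circ_beta A) * w + cnj (circ_alpha A) \<noteq> 0"
proof
  assume "cnj (circ_beta A) * w + cnj (circ_alpha A) = 0"
  then have "cmod (cnj (circ_beta A) * w) = cmod (cnj (circ_alpha A))"
    by (metis add_eq_0_iff norm_minus_cancel)
  then have "cmod (circ_beta A) = cmod (circ_alpha A)"
    using assms(2) by (simp add: norm_mult)
  then show False using cmod_circ[of A] assms(1) by simp
qed

lemma circ_map_sphere:
  assumes "det A = 1" "w \<in> sphere 0 1"
  shows "circ_map A w \<in> sphere 0 1"
proof -
  \<comment> \<open>Since \<open>cnj w * w = 1\<close>, numerator and denominator are conjugate up
    to the unit factor \<open>w\<close>, so their quotient has modulus 1.\<close>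
  have "circ_alpha A * w + circ_beta A = w * cnj (cnj (circ_beta A) * w + cnj (circ_alpha A))"
    using cnj_sphere[OF assms(2)] by (simp add: algebra_simps)
  then have "cmod (circ_alpha A * w + circ_beta A) = cmod (cnj (circ_beta A) * w + cnj (circ_alpha A))"
    using assms(2) by (metis complex_mod_cnj mult_1 norm_mult mem_sphere_0)
  then show ?thesis
    using circ_denominator[OF assms] by (simp add: circ_map_def norm_divide)
qed

lemma circ_map_mult:
  assumes "det A = 1" "det B = 1" "w \<in> sphere 0 1"
  shows "circ_map (A ** B) w = circ_map A (circ_map B w)"
proof -
  let ?N = "circ_alpha B * w + circ_beta B"
  let ?D = "cnj (circ_beta B) * w + cnj (circ_alpha B)"
  have D: "?D \<noteq> 0" using circ_denominator assms by blast
  have "circ_map A (circ_map B w) =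
      (circ_alpha A * ?N + circ_beta A * ?D) / (cnj (circ_beta A) * ?N + cnj (circ_alpha A) * ?D)"
  proof -
    have "a * (n / d) + b = (a * n + b * d) / d" if "d \<noteq> 0" for a b n d :: complex
      using that by (simp add: field_simps)
    from this[OF D] D show ?thesis unfolding circ_map_def by simp
  qed
  then show ?thesis
    unfolding circ_map_def circ_mult by (simp add: algebra_simps)
qed

section \<open>The modular group acting on the circle\<close>

lemma mult_PSL2Z: "{A, - A} \<otimes>\<^bsub>PSL2Z\<^esub> {B, - B} = {A ** B, - (A ** B)}"
  by (auto simp: PSL2Z_def FactGroup_def set_mult_def SL2Z_def minus_matrix_mult)

lemma one_PSL2Z: "\<one>\<^bsub>PSL2Z\<^esub> = {mat 1, - mat 1}"
  by (simp add: PSL2Z_def FactGroup_def)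

lemma PSL2Z_cases:
  assumes "g \<in> carrier PSL2Z"
  obtains A where "g = {A, - A}" "det A = 1"
  using assms unfolding carrier_PSL2Z by blast

lemma circ_compact_action: "compact_action PSL2Z (top_of_set (sphere 0 1)) circ_action"
proof (rule compact_actionI)
  show "compact_space (top_of_set (sphere 0 1 :: complex set))"
    by (simp add: compact_space_subtopology)
  show "Hausdorff_space (top_of_set (sphere 0 1 :: complex set))"
    by (simp add: Hausdorff_space_subtopology)
  have "(1 :: complex) \<in> sphere 0 1" by simp
  then show "topspace (top_of_set (sphere 0 1 :: complex set)) \<noteq> {}"
    unfolding topspace_euclidean_subtopology by blast
  show "group PSL2Z" by (rule group_PSL2Z)
  fix g assume "g \<in> carrier PSL2Z"
  then obtain A where A: "g = {A, - A}" "det A = 1" by (rule PSL2Z_cases)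
  show "circ_action g \<in> extensional (topspace (top_of_set (sphere 0 1)))"
    by (simp add: circ_action_def)
  have "continuous_on (sphere 0 1) (circ_map A)"
    unfolding circ_map_def using circ_denominator[OF A(2)] by (intro continuous_intros) auto
  then have "continuous_on (sphere 0 1) (circ_action g)"
    by (rule continuous_on_eq) (simp add: A circ_action_eq)
  moreover have "circ_action g \<in> sphere 0 1 \<rightarrow> sphere 0 1"
    using A circ_map_sphere circ_action_eq by force
  ultimately show "continuous_map (top_of_set (sphere 0 1)) (top_of_set (sphere 0 1)) (circ_action g)"
    by simp
  fix h assume "h \<in> carrier PSL2Z"
  then obtain B where B: "h = {B, - B}" "det B = 1" by (rule PSL2Z_cases)
  fix w :: complex assume "w \<in> topspace (top_of_set (sphere 0 1))"
  then have w: "w \<in> sphere 0 1" by simp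
  show "circ_action (g \<otimes>\<^bsub>PSL2Z\<^esub> h) w = circ_action g (circ_action h w)"
    unfolding A(1) B(1) mult_PSL2Z circ_action_eq[OF w]
    using circ_map_mult[OF A(2) B(2) w] circ_action_eq[OF circ_map_sphere[OF B(2) w]] by simp
next
  fix w :: complex assume "w \<in> topspace (top_of_set (sphere 0 1))"
  then have w: "w \<in> sphere 0 1" by simp
  have "circ_alpha (mat 1) = 1" "circ_beta (mat 1) = 0"
    by (simp_all add: circ_alpha_def circ_beta_def mat_def complex_eq_iff)
  then show "circ_action \<one>\<^bsub>PSL2Z\<^esub> w = w"
    unfolding one_PSL2Z circ_action_eq[OF w] by (simp add: circ_map_def)
qed

section \<open>Dynamics of the translations \<open>x \<mapsto> x + n\<close> and of the full group
  on the circle\<close>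

definition shift :: "int \<Rightarrow> int^2^2"
  where "shift n = vector [vector [1, n], vector [0, 1]]"

lemma det_shift: "det (shift n) = 1"
  by (simp add: shift_def det_2)

lemma shift_in_Gamma_inf: "{shift n, - shift n} \<in> Gamma_inf"
  unfolding Gamma_inf_eq shift_def by blast

lemma Gamma_inf_subset: "Gamma_inf \<subseteq> carrier PSL2Z"
  unfolding Gamma_inf_eq carrier_PSL2Z using det_shift by (auto simp: shift_def)

lemma Gamma_inf_commutes:
  assumes "g \<in> Gamma_inf"
  shows "g \<otimes>\<^bsub>PSL2Z\<^esub> {shift n, - shift n} = {shift n, - shift n} \<otimes>\<^bsub>PSL2Z\<^esub> g"
proof -
  obtain m where g: "g = {shift m, - shift m}"
    using assms unfolding Gamma_inf_eq shift_def by blast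
  have "shift m ** shift n = shift n ** shift m"
    by (simp add: shift_def vec_eq_iff forall_2 matrix_matrix_mult_def sum_2)
  then show ?thesis unfolding g mult_PSL2Z by simp
qed

text \<open>Translations are parabolic with fixed point 1. For any other \<open>w\<close> the
  distance to 1 is governed by a quotient whose numerator is constant and whose denominator grows
  linearly in \<open>n\<close>.\<close>

lemma circ_shift_tendsto:
  assumes w: "w \<in> sphere 0 1"
  shows "(\<lambda>n. circ_map (shift (int n)) w) \<longlonglongrightarrow> 1"
proof (cases "w = 1")
  case True
  have "circ_map (shift n) 1 = 1" for n
  proof -
    have "circ_alpha (shift n) + circ_beta (shift n) =
        cnj (circ_beta (shift n)) + cnj (circ_alpha (shift n))"
      by (simp add: circ_alpha_def circ_beta_def shift_def complex_eq_iff)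
    then show ?thesis
      using circ_denominator[OF det_shift[of n], of 1] by (simp add: circ_map_def)
  qed
  with True show ?thesis by simp
next
  case False
  \<comment> \<open>The slope of the denominator of \<open>circ_map\<close> as a function of
    \<open>n\<close>; it is nonzero exactly because \<open>w\<close> is not 1.\<close>
  define c where "c = \<i> / 2 * (1 - w)"
  have c: "c \<noteq> 0" using False by (simp add: c_def)
  have eq: "circ_map (shift (int n)) w = 1 + (w - 1) / (1 + of_nat n * c)" for n
  proof -
    have ab: "circ_alpha (shift (int n)) = 1 - \<i> / 2 * of_nat n"
        "circ_beta (shift (int n)) = \<i> / 2 * of_nat n"
      by (simp_all add: circ_alpha_def circ_beta_def shift_def complex_eq_iff)
    have den: "cnj (circ_beta (shift (int n))) * w + cnj (circ_alpha (shift (int n))) = 1 + of_nat n * c"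
      by (simp add: ab c_def field_simps)
    have num: "circ_alpha (shift (int n)) * w + circ_beta (shift (int n)) = (1 + of_nat n * c) + (w - 1)"
      by (simp add: ab c_def field_simps)
    have "1 + of_nat n * c \<noteq> 0"
      using circ_denominator[OF det_shift w] den by metis
    then show ?thesis
      unfolding circ_map_def num den add_divide_distrib[of "1 + of_nat n * c" "w - 1"] by simp
  qed
  have "filterlim (\<lambda>n. of_nat n * c) at_infinity sequentially"
    using tendsto_mult_filterlim_at_infinity[OF tendsto_const c tendsto_of_nat]
    by (simp add: mult.commute)
  then have "filterlim (\<lambda>n. 1 + of_nat n * c) at_infinity sequentially"
    by (rule tendsto_add_filterlim_at_infinity[OF tendsto_const])
  then have "(\<lambda>n. (w - 1) / (1 + of_nat n * c)) \<longlonglongrightarrow> 0"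
    by (rule tendsto_divide_0[OF tendsto_const])
  from tendsto_add[OF tendsto_const[of 1] this] show ?thesis by (simp add: eq)
qed

text \<open>For \<open>r = a / c\<close> in lowest terms, Bezout completes the column
  \<open>(a, c)\<close> to an integer matrix of determinant 1, which sends infinity to
  \<open>r\<close>. The right-hand side is \<open>z / cnj z\<close> for \<open>z = r + \<i>\<close>,
  the circle coordinate of \<open>r\<close>.\<close>

lemma circ_orbit_rational:
  assumes "r \<in> \<rat>"
  shows "\<exists>A. det A = 1 \<and> circ_map A 1 = Complex r 1 / Complex r (- 1)"
proof -
  obtain a c where r: "r = of_int a / of_int c" "c > 0" "coprime a c"
    using assms by (rule Rats_cases')
  obtain x y where xy: "x * a + y * c = 1"
    using r(3) bezout_int[of a c] by (auto simp: coprime_iff_gcd_eq_1)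
  define A :: "int^2^2" where "A = vector [vector [a, - y], vector [c, x]]"
  have "det A = 1" using xy by (simp add: A_def det_2 algebra_simps)
  moreover have "circ_map A 1 = Complex a c / Complex a (- c)"
    unfolding circ_map_def
    by (rule arg_cong2[where f = "(/)"])
      (simp_all add: A_def circ_alpha_def circ_beta_def complex_eq_iff field_simps)
  moreover have "Complex a c = of_int c * Complex r 1" "Complex a (- c) = of_int c * Complex r (- 1)"
    using r by (simp_all add: complex_eq_iff)
  ultimately show ?thesis using r(2) by auto
qed

text \<open>Translations contract any point of \<open>S\<close> to 1, so \<open>S\<close> contains
  1, then the orbit of 1 with all rational points, and by density of the rationals the whole
  circle.\<close>

lemma circ_minimal: "minimal_action PSL2Z (top_of_set (sphere 0 1)) circ_action"
  unfolding minimal_action_def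
proof (intro allI impI, elim conjE)
  fix S :: "complex set"
  assume "closedin (top_of_set (sphere 0 1)) S" and inv: "\<forall>g\<in>carrier PSL2Z. circ_action g ` S \<subseteq> S"
  then have S: "closed S" "S \<subseteq> sphere 0 1"
    by (auto simp: closedin_closed_eq)
  have inv: "circ_map A w \<in> S" if "det A = 1" "w \<in> S" for A w
  proof -
    have "{A, - A} \<in> carrier PSL2Z" using that(1) unfolding carrier_PSL2Z by blast
    then have "circ_action {A, - A} w \<in> S" using inv that(2) by blast
    then show ?thesis using circ_action_eq S(2) that(2) by (metis subsetD)
  qed
  have "sphere 0 1 \<subseteq> S" if w0: "w0 \<in> S" for w0
  proof
    have one: "1 \<in> S"
      using closed_sequentially[OF S(1) _ circ_shift_tendsto] inv[OF det_shift w0] w0 S(2) by blast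
    \<comment> \<open>The circle coordinate of the real number \<open>x\<close>.\<close>
    define q where "q x = Complex x 1 / Complex x (- 1)" for x
    have ne: "Complex x (- 1) \<noteq> 0" for x by (simp add: complex_eq_iff)
    have "continuous_on UNIV q"
      unfolding q_def Complex_eq using ne[unfolded Complex_eq] by (intro continuous_intros) auto
    then have "closed (q -` S)" using S(1) closed_vimage by blast
    moreover have "\<rat> \<subseteq> q -` S"
      using circ_orbit_rational inv[OF _ one] by (auto simp: q_def) metis
    ultimately have q: "q x \<in> S" for x
      using closure_minimal[of \<rat> "q -` S"] Rats_closure_real by blast
    fix w :: complex assume w: "w \<in> sphere 0 1"
    show "w \<in> S"
    proof (cases "w = 1")
      case False
      \<comment> \<open>The solution of \<open>w = (z + \<i>) / (z - \<i>)\<close>; it is real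
        because \<open>w\<close> has modulus 1, so \<open>q\<close> reaches every \<open>w\<close>
        other than 1.\<close>
      define z where "z = \<i> * (w + 1) / (w - 1)"
      have w0: "w \<noteq> 0" using w by auto
      have cw: "cnj w = 1 / w" using cnj_sphere[OF w] w0 by (simp add: field_simps)
      have "cnj z = z"
      proof -
        have "cnj z = - \<i> * (1 / w + 1) / (1 / w - 1)" by (simp add: z_def cw)
        also have "\<dots> = - \<i> * (1 + w) / (1 - w)" using w0 by (simp add: divide_simps)
        also have "\<dots> = z" using False by (simp add: z_def divide_simps) (simp add: algebra_simps)
        finally show ?thesis .
      qed
      then have z: "z = of_real (Re z)" by (metis Reals_cnj_iff of_real_Re)
      have "Complex (Re z) 1 = z + \<i>" "Complex (Re z) (- 1) = z - \<i>"
        by (subst (2) z, simp add: complex_eq_iff)+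
      moreover have "z + \<i> = 2 * \<i> * w / (w - 1)" "z - \<i> = 2 * \<i> / (w - 1)"
        using False by (simp_all add: z_def field_simps)
      ultimately have "q (Re z) = w" using False by (simp add: q_def)
      then show ?thesis using q by metis
    qed (simp add: one)
  qed
  then show "S = {} \<or> S = topspace (top_of_set (sphere 0 1))" using S(2) by auto
qed

text \<open>Clearing the denominator turns the fixed points into roots of a polynomial of degree at
  most 2. It vanishes identically only if \<beta> is 0 and \<alpha> is real, so that the matrix is
  scalar, and determinant 1 leaves plus or minus the identity.\<close>

lemma circ_finite_fixed_points:
  assumes "g \<in> carrier PSL2Z - {\<one>\<^bsub>PSL2Z\<^esub>}"
  shows "finite {w \<in> sphere 0 1. circ_action g w = w}"
proof -
  obtain A where A: "g = {A, - A}" "det A = 1" using assms PSL2Z_cases by blast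
  define P where "P = [:- circ_beta A, cnj (circ_alpha A) - circ_alpha A, cnj (circ_beta A):]"
  have "P \<noteq> 0"
  proof
    assume "P = 0"
    then have "circ_beta A = 0" "cnj (circ_alpha A) = circ_alpha A" by (auto simp: P_def)
    then have "Re (circ_beta A) = 0" "Im (circ_beta A) = 0" "Im (circ_alpha A) = 0"
      by (simp_all add: complex_eq_iff)
    then have "A$1$1 - A$2$2 = 0" "A$1$2 + A$2$1 = 0" "A$2$1 - A$1$2 = 0"
      unfolding circ_alpha_def circ_beta_def complex.sel by simp_all
    then have e: "A$1$1 = A$2$2" "A$1$2 = 0" "A$2$1 = 0" by linarith+
    then have "A$1$1 * A$1$1 = 1" using A(2) by (simp add: det_2)
    then have "A$1$1 = 1 \<or> A$1$1 = - 1" using zmult_eq_1_iff by blast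
    then have "A = mat 1 \<or> A = - mat 1"
      using e by (auto simp: vec_eq_iff forall_2 mat_def)
    then have "g = \<one>\<^bsub>PSL2Z\<^esub>" unfolding A(1) one_PSL2Z by auto
    then show False using assms by blast
  qed
  then have "finite {w. poly P w = 0}" by (rule poly_roots_finite)
  moreover have "poly P w = 0" if w: "w \<in> sphere 0 1" "circ_action g w = w" for w
  proof -
    have "circ_map A w = w" using w A(1) circ_action_eq by metis
    then have "circ_alpha A * w + circ_beta A = w * (cnj (circ_beta A) * w + cnj (circ_alpha A))"
      using circ_denominator[OF A(2) w(1)] by (simp add: circ_map_def divide_eq_eq)
    then show ?thesis by (simp add: P_def algebra_simps)
  qed
  ultimately show ?thesis by (elim finite_subset[rotated]) auto
qed

text \<open>A finite connected set has at most one point, while 1 and -1 both lie on the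
  circle.\<close>

lemma infinite_circle: "infinite (sphere 0 1 :: complex set)"
proof
  assume fin: "finite (sphere 0 1 :: complex set)"
  have "connected (sphere 0 1 :: complex set)" by (rule connected_sphere) simp
  then have "sphere 0 1 = ({} :: complex set) \<or> (\<exists>x :: complex. sphere 0 1 = {x})"
    using connected_finite_iff_sing fin by blast
  moreover have pm: "(1 :: complex) \<in> sphere 0 1" "(- 1 :: complex) \<in> sphere 0 1" by simp_all
  ultimately obtain x :: complex where "sphere 0 1 = {x}" by blast
  with pm have "(1 :: complex) = - 1" by (metis singletonD)
  then show False by simp
qed

theorem proposition4p1:
  fixes B :: "'b topology" and \<beta> :: "(int^2^2) set \<Rightarrow> 'b \<Rightarrow> 'b"
  assumes "universal_boundary PSL2Z Gamma_inf B \<beta>"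
  shows "topologically_free_action PSL2Z B \<beta> \<and> \<not> free_action PSL2Z B \<beta> \<and>
    \<not> extremally_disconnected B"
proof -
  have B: "compact_action PSL2Z B \<beta>" and min: "minimal_action PSL2Z B \<beta>"
    and sp: "strongly_proximal_action (PSL2Z\<lparr>carrier := Gamma_inf\<rparr>) B \<beta>"
    using assms by (auto simp: universal_boundary_def boundary_action_def)
  let ?s = "\<lambda>n. {shift (int n), - shift (int n)}"
  have lim: "limitin (top_of_set (sphere 0 1)) (\<lambda>n. circ_action (?s n) w) 1 sequentially"
    if "w \<in> topspace (top_of_set (sphere 0 1))" for w
  proof -
    have w: "w \<in> sphere 0 1" using that by simp
    show ?thesis
      unfolding circ_action_eq[OF w] limitin_subtopology limitin_canonical_iff
      using circ_shift_tendsto[OF w] circ_map_sphere[OF det_shift w] by simp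
  qed
  \<comment> \<open>The circle is minimal and contracted to 1 by the translations in
    \<open>Gamma_inf\<close>, so universality makes it an equivariant quotient of
    \<open>B\<close>.\<close>
  obtain \<pi> where \<pi>: "\<pi> ` topspace B = topspace (top_of_set (sphere 0 1 :: complex set))"
    "\<And>g x. g \<in> carrier PSL2Z \<Longrightarrow> x \<in> topspace B \<Longrightarrow> \<pi> (\<beta> g x) = circ_action g (\<pi> x)"
    using universal_boundary_contracting[OF assms Gamma_inf_subset circ_compact_action circ_minimal
        shift_in_Gamma_inf _ lim] by auto
  have free: "topologically_free_action PSL2Z B \<beta>"
    using topologically_free_if_finite_fixed_points[OF B min, of \<pi> "sphere 0 1" circ_action]
      \<pi> infinite_circle circ_finite_fixed_points by simp
  \<comment> \<open>The translation by 1. It commutes with \<open>Gamma_inf\<close>, which yields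
    the fixed point \<open>z\<close> below.\<close>
  define t where "t = {shift 1, - shift 1}"
  have t: "t \<in> carrier PSL2Z" using shift_in_Gamma_inf Gamma_inf_subset t_def by blast
  have "shift 1 $ 1 $ 2 \<noteq> (mat 1 :: int^2^2) $ 1 $ 2" "shift 1 $ 1 $ 2 \<noteq> (- mat 1 :: int^2^2) $ 1 $ 2"
    by (simp_all add: shift_def mat_def)
  then have "t \<noteq> \<one>\<^bsub>PSL2Z\<^esub>" unfolding t_def one_PSL2Z by (metis doubleton_eq_iff)
  with t have t1: "t \<in> carrier PSL2Z - {\<one>\<^bsub>PSL2Z\<^esub>}" by blast
  obtain z where z: "z \<in> topspace B" "\<beta> t z = z"
    using strongly_proximal_centralizer_fixed_point[OF B sp Gamma_inf_subset t]
      Gamma_inf_commutes t_def by blast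
  have "\<not> extremally_disconnected B"
  proof
    assume "extremally_disconnected B"
    \<comment> \<open>An open fixed point set would equal its own interior, which is empty by
      topological freeness, yet it contains \<open>z\<close>.\<close>
    then have "openin B {x \<in> topspace B. \<beta> t x = x}"
      using extremally_disconnected_openin_fixed_points compact_actionD(2,5)[OF B] t by blast
    then have "B interior_of {x \<in> topspace B. \<beta> t x = x} = {x \<in> topspace B. \<beta> t x = x}"
      by (simp add: interior_of_openin)
    moreover have "B interior_of {x \<in> topspace B. \<beta> t x = x} = {}"
      using free t1 unfolding topologically_free_action_def by blast
    ultimately show False using z by blast
  qed
  moreover have "\<not> free_action PSL2Z B \<beta>" using z t1 unfolding free_action_def by blast
  ultimately show ?thesis using free by blast
qed

end
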